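(* Suppose $W=\sum_{i=1}^n\gamma_ix^{v_i}$ is a positive, complete Laurent polynomial on the torus $T$ over $\mathbf K$, and $p$ is a critical point of $W$ lying in $T(\mathbf K_{>0})$. Let $\Xi_W$ be the split complete Newton datum associated to $W$ and $d_{\mathrm{crit}}(\Xi_W)\in N_{\mathbb R}$ its canonical point. Then $\operatorname{Val}_T(p)=d_{\mathrm{crit}}(\Xi_W)$.
   Context: Field and torus. $\mathbf K$ is the field of generalised Puiseux series $c(t)=\sum_kc_{\mu_k}t^{\mu_k}$, $c_{\mu_k}\in\mathbb C$, with real exponents forming a strictly increasing sequence that is finite or tends to $+\infty$; $\operatorname{Val}_{\mathbf K}$ is the lowest exponent with nonzero coefficient; $\mathbf K_{>0}$ is the set of nonzero series with leading coefficient in $\mathbb R_{>0}$. $T$ is a split torus over $\mathbf K$ of dimension $r$ with character lattice $M$, cocharacter lattice $N$, dual pairing $\langle\ ,\ \rangle$, $M_{\mathbb R}=M\otimes\mathbb R$, $N_{\mathbb R}=N\otimes\mathbb R$; $T(\mathbf K_{>0})=\operatorname{Hom}(M,\mathbf K_{>0})$, $p^v$ is the value of $p$ on $v\in M$; $\operatorname{Val}_T(p)\in N_{\mathbb R}$ is determined by $\operatorname{Val}_{\mathbf K}(p^v)=\langle v,\operatorname{Val}_T(p)\rangle$ for all $v\in M$. $W=\sum\gamma_ix^{v_i}$ (distinct $v_i\in M$) is positive if all $\gamma_i\in\mathbf K_{>0}$ and complete if $\operatorname{ConvexHull}(\{v_i\})\subset M_{\mathbb R}$ is $r$-dimensional with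 $0$ in its interior. $p$ is a critical point of $W$ if $\sum_i\gamma_i\langle v_i,u\rangle p^{v_i}=0$ for all $u\in N$. Newton data. A Newton datum is a tuple $\Xi=(U,V,\eta,\beta,\mathcal W)$ with $U,V$ finite-dimensional real vector spaces, a short exact sequence $0\to\mathbb R\overset{\eta}\to V\overset{\beta}\to U\to0$, and a finite subset $\mathcal W\subset V$. It is complete if $\operatorname{ConvexHull}(\beta(\mathcal W))$ is full-dimensional in $U$ and contains $0$ in its interior. It is split if a splitting $\tilde\beta:U\to V$ ($\beta\circ\tilde\beta=\mathrm{id}$) is given. Recursion step. Let $\Xi$ be complete with $\dim U>0$. Put $\overline{\mathcal W}=\{w\in\mathcal W\mid\beta(w)\ne0\}$, $\overline\Delta=\operatorname{ConvexHull}(\overline{\mathcal W})$, $\bar\tau=\min\{c\in\mathbb R\mid\eta(c)\in\overline\Delta\}$; let $F$ be the minimal face of $\overline\Delta$ containing $\eta(\bar\tau)$ ($\overline\Delta$ itself is allowed as a face if it is not full-dimensional), and let $E$ be the linear span of $F-\eta(\bar\tau)$. Define $\Xi'=(U/\beta(E),V/E,\eta',\beta',\sigma(\overline{\mathcal W}))$, where $\sigma:V\to V/E$ is the projection and $\eta',\beta'$ are induced by $\eta,\beta$. This is again a complete Newton datum, with $\dim(U/\beta(E))<\dim U$. Canonical point. Given a complete $\Xi$, put $\Xi_1=\Xi$ and $\Xi_{k+1}=(\Xi_k)'$ as long as $\dim U_k>0$, with projections $\sigma_k:V_k\to V_{k+1}$; let $m$ be the first index with $\dim U_m=0$, so $\eta_m:\mathbb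 R\to V_m$ is an isomorphism. Then $\tilde d_{\mathrm{crit}}(\Xi):=\eta_m^{-1}\circ\sigma_{m-1}\circ\cdots\circ\sigma_1\in V^*$. If $\Xi$ is split by $\tilde\beta$, its canonical point is $d_{\mathrm{crit}}(\Xi):=\tilde d_{\mathrm{crit}}(\Xi)\circ\tilde\beta\in U^*$. The datum $\Xi_W$. $\Xi_W=(M_{\mathbb R},\mathbb R\oplus M_{\mathbb R},\eta,\beta,\{(c_i,v_i)\mid i=1,\dots,n\})$ with $c_i=\operatorname{Val}_{\mathbf K}(\gamma_i)$, $\eta(c)=(c,0)$, $\beta(c,v)=v$, splitting $\tilde\beta(v)=(0,v)$; $M_{\mathbb R}^*$ is identified with $N_{\mathbb R}$. *)

theory Defs
  imports "HOL-Analysis.Analysis"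
begin

section \<open>Generalised Puiseux series\<close>

definition puiseux_support :: "real set \<Rightarrow> bool" where
  "puiseux_support S \<longleftrightarrow>
     finite S \<or> (\<exists>\<mu>::nat \<Rightarrow> real. strict_mono \<mu> \<and> filterlim \<mu> at_top sequentially \<and> S = range \<mu>)"

lemma puiseux_support_iff: "puiseux_support S \<longleftrightarrow> (\<forall>x. finite {s\<in>S. s \<le> x})"
proof
  assume "puiseux_support S"
  then consider "finite S" | \<mu> :: "nat \<Rightarrow> real" where "strict_mono \<mu>" "filterlim \<mu> at_top sequentially" "S = range \<mu>"
    unfolding puiseux_support_def by blast
  then show "\<forall>x. finite {s\<in>S. s \<le> x}"
  proof cases
    case 1
    then show ?thesis by auto
  next
    case 2
    show ?thesis
    proof
      fix x
      obtain N where N: "\<And>n. n \<ge> N \<Longrightarrow> \<mu> n > x"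
        using filterlim_at_top_dense[THEN iffD1, OF 2(2), rule_format, of x]
        unfolding eventually_sequentially by blast
      have "{s\<in>S. s \<le> x} \<subseteq> \<mu> ` {..<N}"
      proof
        fix s assume "s \<in> {s\<in>S. s \<le> x}"
        then obtain n where n: "s = \<mu> n" "\<mu> n \<le> x" using 2(3) by auto
        then have "n < N" using N[of n] by (cases "n < N") auto
        then show "s \<in> \<mu> ` {..<N}" using n by simp
      qed
      then show "finite {s\<in>S. s \<le> x}"
        using finite_subset by blast
    qed
  qed
next
  assume fin: "\<forall>x. finite {s\<in>S. s \<le> x}"
  show "puiseux_support S"
  proof (cases "finite S")
    case True
    then show ?thesis by (simp add: puiseux_support_def)
  next
    case False
    define g where "g = (\<lambda>x. card {s\<in>S. s < x})"
    have fin': "finite {s\<in>S. s < x}" for x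
      by (rule finite_subset[OF _ fin[rule_format, of x]]) auto
    have g_less: "g x < g y" if "x \<in> S" "y \<in> S" "x < y" for x y
      unfolding g_def using that by (intro psubset_card_mono fin') auto
    have inj: "inj_on g S"
      by (rule inj_onI) (metis g_less less_irrefl linorder_neqE)
    have down: "k \<in> g ` S" if "x \<in> S" "k < g x" for x k
    proof -
      have "g ` {s\<in>S. s < x} \<subseteq> {..<g x}"
        using g_less that(1) by auto
      moreover have "card (g ` {s\<in>S. s < x}) = card {..<g x}"
        using card_image[OF inj_on_subset[OF inj, of "{s\<in>S. s < x}"]] by (simp add: g_def)
      ultimately have "g ` {s\<in>S. s < x} = {..<g x}"
        by (intro card_subset_eq) auto
      then show ?thesis using that by auto
    qed
    have onto: "g ` S = UNIV"
    proof -
      have "infinite (g ` S)"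
        using False finite_image_iff[OF inj] by simp
      then have "\<exists>x\<in>S. k < g x" for k
        by (metis (no_types, lifting) finite_nat_set_iff_bounded_le image_iff not_le)
      then show ?thesis using down by blast
    qed
    define \<mu> where "\<mu> = inv_into S g"
    have mem: "\<mu> k \<in> S" and gm: "g (\<mu> k) = k" for k
      unfolding \<mu>_def using onto by (auto intro: inv_into_into f_inv_into_f)
    have mono: "strict_mono \<mu>"
    proof (rule strict_monoI)
      fix i j :: nat
      assume "i < j"
      then show "\<mu> i < \<mu> j"
        using g_less[OF mem[of j] mem[of i]] gm by (metis not_less_iff_gr_or_eq)
    qed
    have range: "S = range \<mu>"
      using mem inj unfolding \<mu>_def by (auto simp: image_iff) (metis inv_into_f_f)
    have "filterlim \<mu> at_top sequentially"
      unfolding filterlim_at_top_dense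
    proof
      fix x
      have "finite (\<mu> -` {s\<in>S. s \<le> x})"
        using fin mono by (intro finite_vimageI) (auto simp: strict_mono_imp_inj_on)
      then obtain N where N: "\<And>n. \<mu> n \<le> x \<Longrightarrow> n < N"
        using mem by (auto simp: finite_nat_set_iff_bounded)
      then show "\<forall>\<^sub>F n in sequentially. x < \<mu> n"
        unfolding eventually_sequentially by (metis not_le)
    qed
    then show ?thesis
      unfolding puiseux_support_def using mono range by blast
  qed
qed

typedef puiseux = "{c :: real \<Rightarrow> complex. puiseux_support {\<mu>. c \<mu> \<noteq> 0}}"
  morphisms coeff Puiseux
  by (intro exI[of _ "\<lambda>_. 0"]) (simp add: puiseux_support_def)

lemma puiseux_eqI: "(\<And>x. coeff f x = coeff g x) \<Longrightarrow> f = g"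
  by (simp add: coeff_inject[symmetric] fun_eq_iff)

lemma finite_coeff: "finite {\<mu>. coeff f \<mu> \<noteq> 0 \<and> \<mu> \<le> x}"
  using coeff[of f] by (auto simp: puiseux_support_iff)

lemma coeff_PuiseuxI:
  assumes "\<And>x. finite {\<mu>. c \<mu> \<noteq> 0 \<and> \<mu> \<le> x}"
  shows "coeff (Puiseux c) = c"
  using assms by (intro Puiseux_inverse) (auto simp: puiseux_support_iff)

lemma coeff_bounded_below: obtains l where "\<And>\<mu>. coeff f \<mu> \<noteq> 0 \<Longrightarrow> l \<le> \<mu>"
proof -
  let ?S = "{\<mu>. coeff f \<mu> \<noteq> 0 \<and> \<mu> \<le> 0}"
  have "Min (insert 0 ?S) \<le> \<mu>" if "coeff f \<mu> \<noteq> 0" for \<mu>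
  proof (cases "\<mu> \<le> 0")
    case True
    then show ?thesis using that finite_coeff[of f 0] by (intro Min_le) auto
  next
    case False
    have "Min (insert 0 ?S) \<le> 0" using finite_coeff[of f 0] by (intro Min_le) auto
    then show ?thesis using False by simp
  qed
  then show ?thesis by (rule that)
qed

instantiation puiseux :: ab_group_add
begin

definition "0 = Puiseux (\<lambda>_. 0)"
definition "f + g = Puiseux (\<lambda>x. coeff f x + coeff g x)"
definition "- f = Puiseux (\<lambda>x. - coeff f x)"
definition "f - g = f + (- g :: puiseux)"

lemma coeff_zero [simp]: "coeff 0 x = 0"
  unfolding zero_puiseux_def using coeff_PuiseuxI[of "\<lambda>_. 0"] by simp

lemma coeff_add [simp]: "coeff (f + g) x = coeff f x + coeff g x"
proof -
  have "finite {\<mu>. coeff f \<mu> + coeff g \<mu> \<noteq> 0 \<and> \<mu> \<le> y}" for y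
    by (rule finite_subset[OF _ finite_UnI[OF finite_coeff[of f y] finite_coeff[of g y]]]) auto
  from coeff_PuiseuxI[OF this] show ?thesis by (simp only: plus_puiseux_def)
qed

lemma coeff_uminus [simp]: "coeff (- f) x = - coeff f x"
proof -
  have "finite {\<mu>. - coeff f \<mu> \<noteq> 0 \<and> \<mu> \<le> y}" for y
    by (simp only: neg_equal_0_iff_equal finite_coeff)
  from coeff_PuiseuxI[OF this] show ?thesis by (simp only: uminus_puiseux_def)
qed

instance
proof
  fix f g h :: puiseux
  show "f + g + h = f + (g + h)" by (rule puiseux_eqI) (simp add: add.assoc)
  show "f + g = g + f" by (rule puiseux_eqI) (simp add: add.commute)
  show "0 + f = f" by (rule puiseux_eqI) simp
  show "- f + f = 0" by (rule puiseux_eqI) simp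
  show "f - g = f + - g" by (rule minus_puiseux_def)
qed

end

lemma coeff_diff [simp]: "coeff (f - g) x = coeff f x - coeff g x"
  unfolding minus_puiseux_def coeff_add coeff_uminus by (rule add_uminus_conv_diff)

definition conv_supp :: "puiseux \<Rightarrow> puiseux \<Rightarrow> real \<Rightarrow> real set" where
  "conv_supp f g x = {a. coeff f a \<noteq> 0 \<and> coeff g (x - a) \<noteq> 0}"

lemma finite_conv_supp: "finite (conv_supp f g x)"
proof -
  obtain l where l: "\<And>\<mu>. coeff g \<mu> \<noteq> 0 \<Longrightarrow> l \<le> \<mu>" using coeff_bounded_below by blast
  have "conv_supp f g x \<subseteq> {\<mu>. coeff f \<mu> \<noteq> 0 \<and> \<mu> \<le> x - l}"
  proof
    fix a assume "a \<in> conv_supp f g x"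
    then show "a \<in> {\<mu>. coeff f \<mu> \<noteq> 0 \<and> \<mu> \<le> x - l}"
      using l[of "x - a"] by (auto simp: conv_supp_def)
  qed
  then show ?thesis by (rule finite_subset[OF _ finite_coeff])
qed

instantiation puiseux :: "{one, times}"
begin

definition "1 = Puiseux (\<lambda>x. if x = 0 then 1 else 0)"
definition "f * g = Puiseux (\<lambda>x. \<Sum>a | coeff f a \<noteq> 0 \<and> coeff g (x - a) \<noteq> 0. coeff f a * coeff g (x - a))"

instance ..

end

lemma coeff_one: "coeff 1 x = (if x = 0 then 1 else 0)"
proof -
  have "finite {\<mu>::real. (if \<mu> = 0 then 1 else 0 :: complex) \<noteq> 0 \<and> \<mu> \<le> y}" for y
    by (rule finite_subset[of _ "{0}"]) auto
  from coeff_PuiseuxI[OF this] show ?thesis by (simp only: one_puiseux_def)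
qed

lemma coeff_mult: "coeff (f * g) x = (\<Sum>a\<in>conv_supp f g x. coeff f a * coeff g (x - a))"
  unfolding times_puiseux_def
proof (subst coeff_PuiseuxI, goal_cases)
  case (1 y)
  let ?c = "\<lambda>x. \<Sum>a | coeff f a \<noteq> 0 \<and> coeff g (x - a) \<noteq> 0. coeff f a * coeff g (x - a)"
  obtain l where l: "\<And>\<mu>. coeff f \<mu> \<noteq> 0 \<Longrightarrow> l \<le> \<mu>" using coeff_bounded_below by blast
  obtain l' where l': "\<And>\<mu>. coeff g \<mu> \<noteq> 0 \<Longrightarrow> l' \<le> \<mu>" using coeff_bounded_below by blast
  let ?A = "{\<mu>. coeff f \<mu> \<noteq> 0 \<and> \<mu> \<le> y - l'}"
  let ?B = "{\<mu>. coeff g \<mu> \<noteq> 0 \<and> \<mu> \<le> y - l}"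
  have "{\<mu>. ?c \<mu> \<noteq> 0 \<and> \<mu> \<le> y} \<subseteq> (\<lambda>(a, b). a + b) ` (?A \<times> ?B)"
  proof
    fix \<mu> assume "\<mu> \<in> {\<mu>. ?c \<mu> \<noteq> 0 \<and> \<mu> \<le> y}"
    then have \<mu>: "?c \<mu> \<noteq> 0" "\<mu> \<le> y" by auto
    from \<mu>(1) obtain a where a: "coeff f a \<noteq> 0" "coeff g (\<mu> - a) \<noteq> 0"
      by (rule sum.not_neutral_contains_not_neutral) auto
    with \<mu>(2) have "(a, \<mu> - a) \<in> ?A \<times> ?B" using l[of a] l'[of "\<mu> - a"] by auto
    then show "\<mu> \<in> (\<lambda>(a, b). a + b) ` (?A \<times> ?B)"
      by (rule rev_image_eqI) simp
  qed
  moreover have "finite ((\<lambda>(a, b). a + b) ` (?A \<times> ?B))"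
    by (intro finite_imageI finite_cartesian_product finite_coeff)
  ultimately show ?case by (rule finite_subset)
next
  case 2
  then show ?case by (simp add: conv_supp_def)
qed

lemma coeff_mult_nonzeroE:
  assumes "coeff (f * g) x \<noteq> 0"
  obtains a where "coeff f a \<noteq> 0" "coeff g (x - a) \<noteq> 0"
proof -
  from assms obtain a where "a \<in> conv_supp f g x"
    unfolding coeff_mult by (rule sum.not_neutral_contains_not_neutral)
  then show ?thesis by (intro that[of a]) (simp_all add: conv_supp_def)
qed

lemma coeff_mult_superset:
  assumes "finite A" "conv_supp f g x \<subseteq> A"
  shows "coeff (f * g) x = (\<Sum>a\<in>A. coeff f a * coeff g (x - a))"
  unfolding coeff_mult using assms by (intro sum.mono_neutral_left) (auto simp: conv_supp_def)

lemma conv_supp_commute: "conv_supp g f x = (\<lambda>a. x - a) ` conv_supp f g x"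
proof
  show "conv_supp g f x \<subseteq> (\<lambda>a. x - a) ` conv_supp f g x"
  proof
    fix b assume "b \<in> conv_supp g f x"
    then show "b \<in> (\<lambda>a. x - a) ` conv_supp f g x"
      by (intro image_eqI[of _ _ "x - b"]) (auto simp: conv_supp_def)
  qed
qed (auto simp: conv_supp_def)

lemma puiseux_mult_commute: "f * g = g * (f :: puiseux)"
proof (rule puiseux_eqI)
  fix x
  have "coeff (g * f) x = (\<Sum>a\<in>conv_supp f g x. coeff g (x - a) * coeff f (x - (x - a)))"
    unfolding coeff_mult conv_supp_commute[of g f x]
    by (subst sum.reindex) (auto simp: inj_on_def)
  then show "coeff (f * g) x = coeff (g * f) x"
    by (simp add: coeff_mult mult.commute)
qed

lemma puiseux_mult_distrib: "(f + g) * h = f * h + g * (h :: puiseux)"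
proof (rule puiseux_eqI)
  fix x
  let ?A = "conv_supp f h x \<union> conv_supp g h x"
  have fin: "finite ?A" by (simp add: finite_conv_supp)
  have "conv_supp (f + g) h x \<subseteq> ?A" by (auto simp: conv_supp_def)
  then show "coeff ((f + g) * h) x = coeff (f * h + g * h) x"
    using coeff_mult_superset[OF fin] by (simp add: sum.distrib distrib_right)
qed

lemma puiseux_mult_assoc: "(f * g) * h = f * (g * (h :: puiseux))"
proof (rule puiseux_eqI)
  fix x
  obtain l where l: "\<And>\<mu>. coeff f \<mu> \<noteq> 0 \<Longrightarrow> l \<le> \<mu>" using coeff_bounded_below by blast
  obtain l' where l': "\<And>\<mu>. coeff g \<mu> \<noteq> 0 \<Longrightarrow> l' \<le> \<mu>" using coeff_bounded_below by blast
  obtain l'' where l'': "\<And>\<mu>. coeff h \<mu> \<noteq> 0 \<Longrightarrow> l'' \<le> \<mu>" using coeff_bounded_below by blast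
  define A where "A = {\<mu>. coeff f \<mu> \<noteq> 0 \<and> \<mu> \<le> x - l' - l''}"
  define B where "B = {\<mu>. coeff g \<mu> \<noteq> 0 \<and> \<mu> \<le> x - l - l''}"
  define S where "S = (\<lambda>(a, b). a + b) ` (A \<times> B)"
  have finA: "finite A" and finB: "finite B" and finS: "finite S"
    unfolding A_def B_def S_def by (auto intro: finite_coeff)
  have 1: "coeff ((f * g) * h) x = (\<Sum>s\<in>S. coeff (f * g) s * coeff h (x - s))"
  proof (rule coeff_mult_superset[OF finS], rule subsetI)
    fix s assume s: "s \<in> conv_supp (f * g) h x"
    then have fg: "coeff (f * g) s \<noteq> 0" and hs: "coeff h (x - s) \<noteq> 0" by (auto simp: conv_supp_def)
    from fg obtain a where a: "coeff f a \<noteq> 0" "coeff g (s - a) \<noteq> 0"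
      by (rule coeff_mult_nonzeroE)
    then have "(a, s - a) \<in> A \<times> B"
      using l[of a] l'[of "s - a"] l''[OF hs] by (auto simp: A_def B_def)
    then show "s \<in> S" unfolding S_def by (rule rev_image_eqI) simp
  qed
  have 2: "coeff (f * g) s * coeff h (x - s) = (\<Sum>a\<in>A. coeff f a * coeff g (s - a) * coeff h (x - s))" for s
  proof (cases "coeff h (x - s) = 0")
    case False
    have "conv_supp f g s \<subseteq> A"
    proof
      fix a assume "a \<in> conv_supp f g s"
      then show "a \<in> A"
        using l'[of "s - a"] l''[OF False] by (auto simp: A_def conv_supp_def)
    qed
    then show ?thesis by (simp add: coeff_mult_superset[OF finA] sum_distrib_right)
  qed simp
  have 3: "(\<Sum>s\<in>S. coeff f a * coeff g (s - a) * coeff h (x - s)) = coeff f a * coeff (g * h) (x - a)"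
    if a: "a \<in> A" for a
  proof -
    have "(\<Sum>s\<in>S. coeff f a * coeff g (s - a) * coeff h (x - s)) =
          (\<Sum>b\<in>(\<lambda>s. s - a) ` S. coeff f a * coeff g b * coeff h (x - a - b))"
      by (subst sum.reindex) (auto simp: inj_on_def)
    also have "\<dots> = coeff f a * (\<Sum>b\<in>(\<lambda>s. s - a) ` S. coeff g b * coeff h (x - a - b))"
      by (simp add: sum_distrib_left mult.assoc)
    also have "(\<Sum>b\<in>(\<lambda>s. s - a) ` S. coeff g b * coeff h (x - a - b)) = coeff (g * h) (x - a)"
    proof (rule coeff_mult_superset[symmetric])
      show "finite ((\<lambda>s. s - a) ` S)" using finS by simp
      show "conv_supp g h (x - a) \<subseteq> (\<lambda>s. s - a) ` S"
      proof
        fix b assume b: "b \<in> conv_supp g h (x - a)"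
        then have "(a, b) \<in> A \<times> B"
          using a l[of a] l''[of "x - a - b"] by (auto simp: A_def B_def conv_supp_def)
        then have "a + b \<in> S" unfolding S_def by (rule rev_image_eqI) simp
        then show "b \<in> (\<lambda>s. s - a) ` S" by (rule rev_image_eqI) simp
      qed
    qed
    finally show ?thesis .
  qed
  have 4: "coeff (f * (g * h)) x = (\<Sum>a\<in>A. coeff f a * coeff (g * h) (x - a))"
  proof (rule coeff_mult_superset[OF finA], rule subsetI)
    fix a assume "a \<in> conv_supp f (g * h) x"
    then have fa: "coeff f a \<noteq> 0" and gh: "coeff (g * h) (x - a) \<noteq> 0"
      by (auto simp: conv_supp_def)
    from gh obtain b where b: "coeff g b \<noteq> 0" "coeff h (x - a - b) \<noteq> 0"
      by (rule coeff_mult_nonzeroE)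
    then show "a \<in> A"
      using l'[OF b(1)] l''[OF b(2)] fa by (auto simp: A_def)
  qed
  have "coeff ((f * g) * h) x = (\<Sum>s\<in>S. \<Sum>a\<in>A. coeff f a * coeff g (s - a) * coeff h (x - s))"
    by (simp only: 1 2)
  also have "\<dots> = (\<Sum>a\<in>A. \<Sum>s\<in>S. coeff f a * coeff g (s - a) * coeff h (x - s))"
    by (rule sum.swap)
  also have "\<dots> = coeff (f * (g * h)) x"
    by (simp add: 3 4)
  finally show "coeff ((f * g) * h) x = coeff (f * (g * h)) x" .
qed

instance puiseux :: comm_ring_1
proof
  fix f g h :: puiseux
  show "f * g * h = f * (g * h)" by (rule puiseux_mult_assoc)
  show "f * g = g * f" by (rule puiseux_mult_commute)
  show "(f + g) * h = f * h + g * h" by (rule puiseux_mult_distrib)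
  show "1 * f = f"
  proof (rule puiseux_eqI)
    fix x
    have "coeff (1 * f) x = (\<Sum>a\<in>{0}. coeff 1 a * coeff f (x - a))"
      by (rule coeff_mult_superset) (auto simp: conv_supp_def coeff_one split: if_splits)
    then show "coeff (1 * f) x = coeff f x" by (simp add: coeff_one)
  qed
  show "(0::puiseux) \<noteq> 1"
  proof
    assume "(0::puiseux) = 1"
    then have "coeff 0 0 = coeff 1 0" by (rule arg_cong)
    then show False by (simp only: coeff_zero coeff_one if_True refl zero_neq_one simp_thms)
  qed
qed

lemma puiseux_geometric:
  assumes "\<epsilon> > 0" and g: "\<And>\<mu>. coeff g \<mu> \<noteq> 0 \<Longrightarrow> \<epsilon> \<le> \<mu>"
  shows "\<exists>h. (1 - g) * h = 1"
proof -
  have pow: "real k * \<epsilon> \<le> \<mu>" if "coeff (g ^ k) \<mu> \<noteq> 0" for k \<mu>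
    using that
  proof (induction k arbitrary: \<mu>)
    case 0
    then show ?case by (simp add: coeff_one split: if_splits)
  next
    case (Suc k)
    then have "coeff (g * g ^ k) \<mu> \<noteq> 0" by simp
    then obtain a where "coeff g a \<noteq> 0" "coeff (g ^ k) (\<mu> - a) \<noteq> 0"
      by (rule coeff_mult_nonzeroE)
    then show ?case using Suc.IH[of "\<mu> - a"] g[of a] by (simp add: algebra_simps)
  qed
  define P where "P = (\<lambda>n. \<Sum>k<n. g ^ k)"
  have P: "(1 - g) * P n = 1 - g ^ n" for n
    unfolding P_def by (rule one_diff_power_eq[symmetric])
  define K where "K = (\<lambda>x. nat \<lceil>x / \<epsilon>\<rceil> + 1)"
  have K: "x < real n * \<epsilon>" if "K x \<le> n" for x n
  proof -
    have "x / \<epsilon> < real n" using that unfolding K_def by linarith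
    then show ?thesis using \<open>\<epsilon> > 0\<close> by (simp add: field_simps)
  qed
  have stable: "coeff (P n) x = coeff (P m) x" if "K x \<le> m" "m \<le> n" for n m x
    using that(2)
  proof (induction n rule: dec_induct)
    case (step n)
    have "coeff (g ^ n) x = 0"
    proof (rule ccontr)
      assume "coeff (g ^ n) x \<noteq> 0"
      then have "real n * \<epsilon> \<le> x" by (rule pow)
      moreover have "x < real n * \<epsilon>" by (rule K) (use that(1) step.hyps(1) in linarith)
      ultimately show False by simp
    qed
    then show ?case using step.IH by (simp add: P_def)
  qed simp
  define h where "h = Puiseux (\<lambda>x. coeff (P (K x)) x)"
  have K_mono: "K x \<le> K y" if "x \<le> y" for x y
    unfolding K_def using that \<open>\<epsilon> > 0\<close>
    by (intro add_mono nat_mono ceiling_mono divide_right_mono) auto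
  have h: "coeff h x = coeff (P (K x)) x" for x
  proof -
    have "finite {\<mu>. coeff (P (K \<mu>)) \<mu> \<noteq> 0 \<and> \<mu> \<le> y}" for y
    proof (rule finite_subset[OF subsetI finite_coeff[of "P (K y)" y]])
      fix \<mu> assume "\<mu> \<in> {\<mu>. coeff (P (K \<mu>)) \<mu> \<noteq> 0 \<and> \<mu> \<le> y}"
      then have \<mu>: "coeff (P (K \<mu>)) \<mu> \<noteq> 0" "\<mu> \<le> y" by simp_all
      have "coeff (P (K y)) \<mu> = coeff (P (K \<mu>)) \<mu>"
        by (rule stable[OF order_refl K_mono[OF \<mu>(2)]])
      with \<mu> show "\<mu> \<in> {\<mu>. coeff (P (K y)) \<mu> \<noteq> 0 \<and> \<mu> \<le> y}" by simp
    qed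
    from coeff_PuiseuxI[OF this] show ?thesis by (simp only: h_def)
  qed
  have "(1 - g) * h = 1"
  proof (rule puiseux_eqI)
    fix x
    let ?n = "K x"
    have nn: "0 \<le> a" if "coeff (1 - g) a \<noteq> 0" for a
    proof -
      have "a = 0 \<or> coeff g a \<noteq> 0" using that by (auto simp: coeff_one split: if_splits)
      then show ?thesis using g[of a] \<open>\<epsilon> > 0\<close> by auto
    qed
    let ?A = "conv_supp (1 - g) h x \<union> conv_supp (1 - g) (P ?n) x"
    have fin: "finite ?A" by (simp add: finite_conv_supp)
    have "coeff ((1 - g) * h) x = (\<Sum>a\<in>?A. coeff (1 - g) a * coeff h (x - a))"
      by (rule coeff_mult_superset[OF fin]) auto
    also have "\<dots> = (\<Sum>a\<in>?A. coeff (1 - g) a * coeff (P ?n) (x - a))"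
    proof (rule sum.cong[OF refl])
      fix a assume "a \<in> ?A"
      then have "0 \<le> a" using nn by (auto simp: conv_supp_def)
      then have "K (x - a) \<le> ?n" by (intro K_mono) simp
      then show "coeff (1 - g) a * coeff h (x - a) = coeff (1 - g) a * coeff (P ?n) (x - a)"
        using stable[of "x - a" "K (x - a)" ?n] by (simp add: h)
    qed
    also have "\<dots> = coeff ((1 - g) * P ?n) x"
      by (rule coeff_mult_superset[OF fin, symmetric]) auto
    also have "\<dots> = coeff 1 x - coeff (g ^ ?n) x"
      by (simp add: P)
    also have "coeff (g ^ ?n) x = 0"
    proof (rule ccontr)
      assume "coeff (g ^ ?n) x \<noteq> 0"
      then have "real ?n * \<epsilon> \<le> x" by (rule pow)
      moreover have "x < real ?n * \<epsilon>" by (rule K) simp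
      ultimately show False by simp
    qed
    finally show "coeff ((1 - g) * h) x = coeff 1 x" by simp
  qed
  then show ?thesis ..
qed

definition puiseux_monom :: "complex \<Rightarrow> real \<Rightarrow> puiseux" where
  "puiseux_monom c \<mu> = Puiseux (\<lambda>x. if x = \<mu> then c else 0)"

lemma coeff_monom: "coeff (puiseux_monom c \<mu>) x = (if x = \<mu> then c else 0)"
proof -
  have "finite {x. (if x = \<mu> then c else 0) \<noteq> 0 \<and> x \<le> y}" for y
    by (rule finite_subset[of _ "{\<mu>}"]) auto
  from coeff_PuiseuxI[OF this] show ?thesis by (simp only: puiseux_monom_def)
qed

lemma coeff_monom_mult: "coeff (puiseux_monom c \<mu> * f) x = c * coeff f (x - \<mu>)"
proof -
  have "coeff (puiseux_monom c \<mu> * f) x = (\<Sum>a\<in>{\<mu>}. coeff (puiseux_monom c \<mu>) a * coeff f (x - a))"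
    by (rule coeff_mult_superset) (auto simp: conv_supp_def coeff_monom split: if_splits)
  then show ?thesis by (simp add: coeff_monom)
qed

text \<open>The value at \<open>0\<close> is unspecified.\<close>

definition Val_K :: "puiseux \<Rightarrow> real" where
  "Val_K f = (LEAST \<mu>. coeff f \<mu> \<noteq> 0)"

lemma Val_K:
  assumes "f \<noteq> 0"
  shows "coeff f (Val_K f) \<noteq> 0" and "\<And>\<mu>. coeff f \<mu> \<noteq> 0 \<Longrightarrow> Val_K f \<le> \<mu>"
proof -
  obtain x where x: "coeff f x \<noteq> 0" using assms by (metis coeff_zero puiseux_eqI)
  let ?S = "{\<mu>. coeff f \<mu> \<noteq> 0 \<and> \<mu> \<le> x}"
  have fin: "finite ?S" and ne: "?S \<noteq> {}" using x finite_coeff by auto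
  have low: "Min ?S \<le> \<mu>" if "coeff f \<mu> \<noteq> 0" for \<mu>
  proof (cases "\<mu> \<le> x")
    case True
    then show ?thesis using that fin by (intro Min_le) auto
  next
    case False
    have "Min ?S \<le> x" using x fin by (intro Min_le) auto
    then show ?thesis using False by simp
  qed
  have "Min ?S \<in> ?S" using fin ne by (rule Min_in)
  then have "Val_K f = Min ?S" unfolding Val_K_def using low by (intro Least_equality) auto
  then show "coeff f (Val_K f) \<noteq> 0" "\<And>\<mu>. coeff f \<mu> \<noteq> 0 \<Longrightarrow> Val_K f \<le> \<mu>"
    using \<open>Min ?S \<in> ?S\<close> low by auto
qed

lemma puiseux_inverse_exists:
  assumes "f \<noteq> 0"
  shows "\<exists>h. f * h = (1 :: puiseux)"
proof -
  define v where "v = Val_K f"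
  define c where "c = coeff f v"
  have c: "c \<noteq> 0" and v: "\<And>\<mu>. coeff f \<mu> \<noteq> 0 \<Longrightarrow> v \<le> \<mu>"
    using Val_K[OF assms] by (auto simp: v_def c_def)
  let ?m = "puiseux_monom (1 / c) (- v)"
  define g where "g = 1 - ?m * f"
  have cg: "coeff g x = (if x = 0 then 1 else 0) - coeff f (x + v) / c" for x
    by (simp add: g_def coeff_one coeff_monom_mult)
  have pos: "0 < x" if "coeff g x \<noteq> 0" for x
  proof -
    have "x \<noteq> 0" using that c by (auto simp: cg c_def)
    moreover from this have "coeff f (x + v) \<noteq> 0" using that by (auto simp: cg)
    then have "v \<le> x + v" by (rule v)
    ultimately show ?thesis by simp
  qed
  have "\<exists>\<epsilon>>0. \<forall>x. coeff g x \<noteq> 0 \<longrightarrow> \<epsilon> \<le> x"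
  proof (cases "g = 0")
    case True
    then show ?thesis by (intro exI[of _ 1]) auto
  next
    case False
    then show ?thesis using Val_K[OF False] pos by blast
  qed
  then obtain h where "(1 - g) * h = 1" using puiseux_geometric by blast
  then have "f * (?m * h) = 1" by (simp add: g_def algebra_simps)
  then show ?thesis ..
qed

instantiation puiseux :: field
begin

definition "inverse f = (if f = 0 then 0 else (THE h. f * h = (1 :: puiseux)))"
definition "f div g = f * inverse (g :: puiseux)"

instance
proof
  fix f g :: puiseux
  show "f div g = f * inverse g" by (rule divide_puiseux_def)
  show "inverse (0 :: puiseux) = 0" by (simp add: inverse_puiseux_def)
  assume "f \<noteq> 0"
  then obtain h where h: "f * h = 1" using puiseux_inverse_exists by blast
  have "(THE h. f * h = 1) = h"
  proof (rule the_equality)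
    show "f * h = 1" by (rule h)
  next
    fix k assume "f * k = 1"
    have "k = (f * h) * k" by (simp only: h mult_1)
    also have "\<dots> = h * (f * k)" by (simp only: mult.assoc mult.left_commute)
    also have "\<dots> = h" by (simp only: \<open>f * k = 1\<close> mult_1_right)
    finally show "k = h" .
  qed
  then show "inverse f * f = 1"
    using h \<open>f \<noteq> 0\<close> by (simp add: inverse_puiseux_def mult.commute)
qed

end

definition puiseux_pos :: "puiseux set" where
  "puiseux_pos = {f. f \<noteq> 0 \<and> (\<exists>r>0. coeff f (Val_K f) = complex_of_real r)}"

section \<open>Tori and Laurent polynomials\<close>

text \<open>
  A lattice \<open>M\<close> of arbitrary finite rank is given inside its real vector space
  \<open>M\<^sub>\<real> = span M\<close>: the sub-\<open>\<int>\<close>-module generated by \<open>\<real>\<close>-linearly independent vectors.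
  The rank is \<open>dim M\<close>; it may be smaller than the dimension of the ambient type and may be 0.
\<close>

definition is_lattice :: "'a::euclidean_space set \<Rightarrow> bool" where
  "is_lattice M \<longleftrightarrow>
     (\<exists>B. independent B \<and> M = {\<Sum>b\<in>B. real_of_int (k b) *\<^sub>R b | k. True})"

text \<open>
  The cocharacter lattice \<open>N = Hom(M, \<int>)\<close>; the pairing of \<open>v \<in> M\<close> with \<open>u \<in> N\<close> is \<open>u v\<close>.
  Only the values of \<open>u\<close> on \<open>M\<close> are constrained.
\<close>

definition cocharacters :: "'a::euclidean_space set \<Rightarrow> ('a \<Rightarrow> int) set" where
  "cocharacters M = {u. \<forall>v\<in>M. \<forall>w\<in>M. u (v + w) = u v + u w}"

text \<open>
  The dual of a subspace \<open>V\<close>, as extensional functions on \<open>V\<close> so that equality of functionals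
  is equality of functions. The space \<open>N\<^sub>\<real>\<close> is identified with the dual of \<open>M\<^sub>\<real>\<close>.
\<close>

definition dual_space :: "'a::euclidean_space set \<Rightarrow> ('a \<Rightarrow> real) set" where
  "dual_space V = {\<phi> \<in> extensional V.
     (\<forall>x\<in>V. \<forall>y\<in>V. \<phi> (x + y) = \<phi> x + \<phi> y) \<and> (\<forall>a. \<forall>x\<in>V. \<phi> (a *\<^sub>R x) = a * \<phi> x)}"

definition torus_pos :: "'a::euclidean_space set \<Rightarrow> ('a \<Rightarrow> puiseux) set" where
  "torus_pos M = {p. (\<forall>v\<in>M. p v \<in> puiseux_pos) \<and> (\<forall>v\<in>M. \<forall>w\<in>M. p (v + w) = p v * p w)}"

definition Val_T :: "'a::euclidean_space set \<Rightarrow> ('a \<Rightarrow> puiseux) \<Rightarrow> 'a \<Rightarrow> real" where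
  "Val_T M p = (THE \<phi>. \<phi> \<in> dual_space (span M) \<and> (\<forall>v\<in>M. Val_K (p v) = \<phi> v))"

definition full_dim_zero_interior :: "'a::euclidean_space set \<Rightarrow> 'a set \<Rightarrow> bool" where
  "full_dim_zero_interior A S \<longleftrightarrow>
     convex hull S \<subseteq> A \<and> aff_dim (convex hull S) = int (dim A) \<and>
     0 \<in> top_of_set A interior_of (convex hull S)"

text \<open>
  The Laurent polynomial \<open>\<Sum>i=1..n. \<gamma> i x\<^bsup>v i\<^esup>\<close> is given by its
  number of terms \<open>n\<close>, its coefficients \<open>\<gamma>\<close> and its exponents \<open>v\<close>.
\<close>

definition laurent_exponents :: "'a::euclidean_space set \<Rightarrow> nat \<Rightarrow> (nat \<Rightarrow> 'a) \<Rightarrow> bool" where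
  "laurent_exponents M n v \<longleftrightarrow> v ` {1..n} \<subseteq> M \<and> inj_on v {1..n}"

definition positive_laurent :: "nat \<Rightarrow> (nat \<Rightarrow> puiseux) \<Rightarrow> bool" where
  "positive_laurent n \<gamma> \<longleftrightarrow> (\<forall>i\<in>{1..n}. \<gamma> i \<in> puiseux_pos)"

definition complete_laurent :: "'a::euclidean_space set \<Rightarrow> nat \<Rightarrow> (nat \<Rightarrow> 'a) \<Rightarrow> bool" where
  "complete_laurent M n v \<longleftrightarrow> full_dim_zero_interior (span M) (v ` {1..n})"

definition critical_point ::
    "'a::euclidean_space set \<Rightarrow> nat \<Rightarrow> (nat \<Rightarrow> puiseux) \<Rightarrow> (nat \<Rightarrow> 'a) \<Rightarrow> ('a \<Rightarrow> puiseux) \<Rightarrow> bool" where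
  "critical_point M n \<gamma> v p \<longleftrightarrow>
     (\<forall>u\<in>cocharacters M. (\<Sum>i=1..n. \<gamma> i * of_int (u (v i)) * p (v i)) = 0)"

section \<open>Newton data\<close>

text \<open>
  Finite-dimensional real vector spaces are subspaces of Euclidean types. The linear maps are
  defined on the whole types, but only their values on the relevant subspaces matter.
\<close>

record ('u, 'v) newton_data =
  nd_U :: "'u set"
  nd_V :: "'v set"
  nd_eta :: "real \<Rightarrow> 'v"
  nd_beta :: "'v \<Rightarrow> 'u"
  nd_W :: "'v set"

definition newton_datum :: "('u::euclidean_space, 'v::euclidean_space) newton_data \<Rightarrow> bool" where
  "newton_datum \<Xi> \<longleftrightarrow>
     subspace (nd_U \<Xi>) \<and> subspace (nd_V \<Xi>) \<and>
     linear (nd_eta \<Xi>) \<and> inj (nd_eta \<Xi>) \<and>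
     linear (nd_beta \<Xi>) \<and> nd_beta \<Xi> ` nd_V \<Xi> = nd_U \<Xi> \<and>
     {x \<in> nd_V \<Xi>. nd_beta \<Xi> x = 0} = range (nd_eta \<Xi>) \<and>
     finite (nd_W \<Xi>) \<and> nd_W \<Xi> \<subseteq> nd_V \<Xi>"

definition complete_datum :: "('u::euclidean_space, 'v::euclidean_space) newton_data \<Rightarrow> bool" where
  "complete_datum \<Xi> \<longleftrightarrow>
     newton_datum \<Xi> \<and> full_dim_zero_interior (nd_U \<Xi>) (nd_beta \<Xi> ` nd_W \<Xi>)"

definition is_splitting ::
    "('u::euclidean_space, 'v::euclidean_space) newton_data \<Rightarrow> ('u \<Rightarrow> 'v) \<Rightarrow> bool" where
  "is_splitting \<Xi> s \<longleftrightarrow>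
     linear s \<and> s ` nd_U \<Xi> \<subseteq> nd_V \<Xi> \<and> (\<forall>u\<in>nd_U \<Xi>. nd_beta \<Xi> (s u) = u)"

text \<open>
  For subspaces \<open>E \<subseteq> V\<close>, each coset in \<open>V/E\<close> is represented by its unique element orthogonal to
  \<open>E\<close>. So \<open>coset_rep E\<close> is the projection \<open>V \<rightarrow> V/E\<close> and \<open>coset_rep E ` V\<close> is the
  space \<open>V/E\<close>, a subspace of the same type: \<open>coset_rep E\<close> is linear with kernel \<open>E\<close>.
\<close>

definition coset_rep :: "'a::euclidean_space set \<Rightarrow> 'a \<Rightarrow> 'a" where
  "coset_rep E x = (THE y. x - y \<in> E \<and> (\<forall>e\<in>E. orthogonal e y))"

lemma coset_rep_unique:
  fixes E :: "'a::euclidean_space set"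
  assumes "subspace E"
  shows "\<exists>!y. x - y \<in> E \<and> (\<forall>e\<in>E. orthogonal e y)"
proof -
  obtain e y where *: "e \<in> span E" "\<And>w. w \<in> span E \<Longrightarrow> orthogonal y w" "x = e + y"
    using orthogonal_subspace_decomp_exists[of E x] by blast
  have E: "span E = E" using assms by (simp add: span_eq_iff)
  show ?thesis
  proof (rule ex1I[of _ y])
    show "x - y \<in> E \<and> (\<forall>e\<in>E. orthogonal e y)"
      using * E by (auto simp: orthogonal_commute)
  next
    fix z assume z: "x - z \<in> E \<and> (\<forall>e\<in>E. orthogonal e z)"
    have "x - y \<in> E" using * E by simp
    then have "(x - y) - (x - z) \<in> E" using z subspace_diff[OF assms] by blast
    moreover have "(x - y) - (x - z) = z - y" by simp
    ultimately have zy: "z - y \<in> E" by (simp only:)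
    have "orthogonal (z - y) z" "orthogonal (z - y) y"
      using z zy *(2)[of "z - y"] E by (metis orthogonal_commute)+
    then have "orthogonal (z - y) (z - y)"
      by (simp add: orthogonal_def inner_diff_right)
    then show "z = y" by (simp add: orthogonal_self)
  qed
qed

lemma coset_rep:
  assumes "subspace E"
  shows "x - coset_rep E x \<in> E" and "e \<in> E \<Longrightarrow> orthogonal e (coset_rep E x)"
  using theI'[OF coset_rep_unique[OF assms, of x]] unfolding coset_rep_def by auto

lemma coset_rep_eqI:
  assumes "subspace E" "x - y \<in> E" "\<And>e. e \<in> E \<Longrightarrow> orthogonal e y"
  shows "coset_rep E x = y"
  unfolding coset_rep_def using assms by (intro the1_equality coset_rep_unique) auto

lemma linear_coset_rep:
  assumes "subspace E"
  shows "linear (coset_rep E)"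
proof (rule linearI)
  fix x y :: 'a and a :: real
  note c = coset_rep[OF assms]
  have "(x - coset_rep E x) + (y - coset_rep E y) \<in> E"
    using c(1) assms by (intro subspace_add)
  then show "coset_rep E (x + y) = coset_rep E x + coset_rep E y"
    using c(2) by (intro coset_rep_eqI assms) (auto simp: orthogonal_clauses algebra_simps)
  have "a *\<^sub>R (x - coset_rep E x) \<in> E"
    using c(1) assms by (intro subspace_scale)
  then show "coset_rep E (a *\<^sub>R x) = a *\<^sub>R coset_rep E x"
    using c(2) by (intro coset_rep_eqI assms) (auto simp: orthogonal_clauses scaleR_diff_right)
qed

lemma coset_rep_eq_0_iff:
  assumes "subspace E"
  shows "coset_rep E x = 0 \<longleftrightarrow> x \<in> E"
  using coset_rep(1)[OF assms, of x] coset_rep_eqI[OF assms, of x 0]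
  by (auto simp: orthogonal_clauses)

lemma coset_rep_eq_iff:
  assumes "subspace E"
  shows "coset_rep E x = coset_rep E y \<longleftrightarrow> x - y \<in> E"
  using coset_rep_eq_0_iff[OF assms, of "x - y"] linear_diff[OF linear_coset_rep[OF assms], of x y]
  by auto

lemma coset_rep_idem:
  assumes "subspace E"
  shows "coset_rep E (coset_rep E x) = coset_rep E x"
  using coset_rep[OF assms] by (intro coset_rep_eqI assms) (auto simp: subspace_0 assms)

definition nd_Wbar :: "('u::euclidean_space, 'v::euclidean_space) newton_data \<Rightarrow> 'v set" where
  "nd_Wbar \<Xi> = {w \<in> nd_W \<Xi>. nd_beta \<Xi> w \<noteq> 0}"

definition nd_Delta :: "('u::euclidean_space, 'v::euclidean_space) newton_data \<Rightarrow> 'v set" where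
  "nd_Delta \<Xi> = convex hull (nd_Wbar \<Xi>)"

definition nd_tau :: "('u::euclidean_space, 'v::euclidean_space) newton_data \<Rightarrow> real" where
  "nd_tau \<Xi> = (LEAST c. nd_eta \<Xi> c \<in> nd_Delta \<Xi>)"

definition nd_face :: "('u::euclidean_space, 'v::euclidean_space) newton_data \<Rightarrow> 'v set" where
  "nd_face \<Xi> =
     \<Inter> {F. F face_of nd_Delta \<Xi> \<and> nd_eta \<Xi> (nd_tau \<Xi>) \<in> F \<and>
           (F = nd_Delta \<Xi> \<longrightarrow> aff_dim (nd_Delta \<Xi>) < int (dim (nd_V \<Xi>)))}"

definition nd_E :: "('u::euclidean_space, 'v::euclidean_space) newton_data \<Rightarrow> 'v set" where
  "nd_E \<Xi> = span ((\<lambda>x. x - nd_eta \<Xi> (nd_tau \<Xi>)) ` nd_face \<Xi>)"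

definition nd_sigma :: "('u::euclidean_space, 'v::euclidean_space) newton_data \<Rightarrow> 'v \<Rightarrow> 'v" where
  "nd_sigma \<Xi> = coset_rep (nd_E \<Xi>)"

definition nd_rho :: "('u::euclidean_space, 'v::euclidean_space) newton_data \<Rightarrow> 'u \<Rightarrow> 'u" where
  "nd_rho \<Xi> = coset_rep (nd_beta \<Xi> ` nd_E \<Xi>)"

definition nd_step ::
    "('u::euclidean_space, 'v::euclidean_space) newton_data \<Rightarrow> ('u, 'v) newton_data" where
  "nd_step \<Xi> =
     \<lparr> nd_U = nd_rho \<Xi> ` nd_U \<Xi>,
       nd_V = nd_sigma \<Xi> ` nd_V \<Xi>,
       nd_eta = nd_sigma \<Xi> \<circ> nd_eta \<Xi>,
       nd_beta = nd_rho \<Xi> \<circ> nd_beta \<Xi>,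
       nd_W = nd_sigma \<Xi> ` nd_Wbar \<Xi> \<rparr>"

text \<open>On representatives, the map induced by \<open>\<beta>\<close> is \<open>\<rho> \<circ> \<beta>\<close>:\<close>

lemma nd_step_beta_induced:
  assumes "linear (nd_beta \<Xi>)"
  shows "nd_beta (nd_step \<Xi>) (nd_sigma \<Xi> x) = nd_rho \<Xi> (nd_beta \<Xi> x)"
proof -
  have E: "subspace (nd_E \<Xi>)" by (simp add: nd_E_def)
  then have bE: "subspace (nd_beta \<Xi> ` nd_E \<Xi>)"
    by (rule linear_subspace_image[OF assms])
  have "x - nd_sigma \<Xi> x \<in> nd_E \<Xi>"
    unfolding nd_sigma_def by (rule coset_rep(1)[OF E])
  then have "nd_beta \<Xi> x - nd_beta \<Xi> (nd_sigma \<Xi> x) \<in> nd_beta \<Xi> ` nd_E \<Xi>"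
    by (metis assms image_eqI linear_diff)
  then show ?thesis
    by (simp add: nd_step_def nd_rho_def coset_rep_eq_iff[OF bE, symmetric])
qed

text \<open>The data \<open>\<Xi>\<^sub>1, \<Xi>\<^sub>2, \<dots>\<close> are indexed from 0 here.\<close>

definition nd_iter ::
    "('u::euclidean_space, 'v::euclidean_space) newton_data \<Rightarrow> nat \<Rightarrow> ('u, 'v) newton_data" where
  "nd_iter \<Xi> k = (nd_step ^^ k) \<Xi>"

definition nd_last :: "('u::euclidean_space, 'v::euclidean_space) newton_data \<Rightarrow> nat" where
  "nd_last \<Xi> = (LEAST k. dim (nd_U (nd_iter \<Xi> k)) = 0)"

fun nd_proj :: "('u::euclidean_space, 'v::euclidean_space) newton_data \<Rightarrow> nat \<Rightarrow> 'v \<Rightarrow> 'v" where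
  "nd_proj \<Xi> 0 = id"
| "nd_proj \<Xi> (Suc k) = nd_sigma (nd_iter \<Xi> k) \<circ> nd_proj \<Xi> k"

definition d_crit_tilde :: "('u::euclidean_space, 'v::euclidean_space) newton_data \<Rightarrow> 'v \<Rightarrow> real" where
  "d_crit_tilde \<Xi> =
     restrict (inv (nd_eta (nd_iter \<Xi> (nd_last \<Xi>))) \<circ> nd_proj \<Xi> (nd_last \<Xi>)) (nd_V \<Xi>)"

definition d_crit ::
    "('u::euclidean_space, 'v::euclidean_space) newton_data \<Rightarrow> ('u \<Rightarrow> 'v) \<Rightarrow> 'u \<Rightarrow> real" where
  "d_crit \<Xi> s = restrict (d_crit_tilde \<Xi> \<circ> s) (nd_U \<Xi>)"

definition laurent_datum ::
    "'a::euclidean_space set \<Rightarrow> nat \<Rightarrow> (nat \<Rightarrow> puiseux) \<Rightarrow> (nat \<Rightarrow> 'a) \<Rightarrow> ('a, real \<times> 'a) newton_data" where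
  "laurent_datum M n \<gamma> v =
     \<lparr> nd_U = span M,
       nd_V = UNIV \<times> span M,
       nd_eta = (\<lambda>c. (c, 0)),
       nd_beta = snd,
       nd_W = {(Val_K (\<gamma> i), v i) | i. i \<in> {1..n}} \<rparr>"

definition laurent_splitting :: "'a::euclidean_space \<Rightarrow> real \<times> 'a" where
  "laurent_splitting x = (0, x)"

lemma complete_laurent_datum:
  assumes "laurent_exponents M n v" "complete_laurent M n v"
  shows "complete_datum (laurent_datum M n \<gamma> (v :: nat \<Rightarrow> 'a::euclidean_space))"
    and "is_splitting (laurent_datum M n \<gamma> v) laurent_splitting"
proof -
  have W: "{(Val_K (\<gamma> i), v i) | i. i \<in> {1..n}} = (\<lambda>i. (Val_K (\<gamma> i), v i)) ` {1..n}"
    by auto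
  have "snd ` {(Val_K (\<gamma> i), v i) | i. i \<in> {1..n}} = v ` {1..n}"
    unfolding W image_image by simp
  then have conv: "full_dim_zero_interior (span M) (snd ` {(Val_K (\<gamma> i), v i) | i. i \<in> {1..n}})"
    using assms(2) by (simp only: complete_laurent_def)
  have "v ` {1..n} \<subseteq> span M"
    using assms(1) span_superset[of M] unfolding laurent_exponents_def by blast
  then have sub: "{(Val_K (\<gamma> i), v i) | i. i \<in> {1..n}} \<subseteq> UNIV \<times> span M"
    by blast
  have fin: "finite {(Val_K (\<gamma> i), v i) | i. i \<in> {1..n}}"
    unfolding W by simp
  have V: "subspace ((UNIV :: real set) \<times> span M)"
    by (intro subspace_Times) auto
  have eta: "linear (\<lambda>c::real. (c, 0::'a))"
    by (intro linearI) auto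
  have exact: "{x \<in> UNIV \<times> span M. snd x = 0} = range (\<lambda>c::real. (c, 0::'a))"
    by (auto simp: span_zero)
  show "complete_datum (laurent_datum M n \<gamma> v)"
    unfolding complete_datum_def newton_datum_def laurent_datum_def newton_data.simps
    using conv sub fin V eta exact by (auto simp: linear_snd inj_on_def)
  show "is_splitting (laurent_datum M n \<gamma> v) laurent_splitting"
    unfolding is_splitting_def laurent_datum_def laurent_splitting_def
    by (auto intro!: linearI)
qed

end

(*
  Let phi = Val_T p and Phi(c, v) = c + phi(v), the valuation of the term of W with Newton
  vector (c, v), evaluated at p. In a vanishing sum with positive leading coefficients the
  terms of lowest valuation must cancel, so 0 lies in the convex hull of the exponents
  minimising Phi among the nonzero exponents. Hence eta(tau) lies in the face Phi = tau of
  the polytope Delta, where tau is the minimum of Phi. So Phi is constant on the minimal face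
  F and descends to the quotient by E, where the same cancellation property holds. After the
  last step V is the image of eta, on which Phi is the inverse of eta.
*)
theory Submission
  imports Defs
begin

section \<open>Valuations and leading coefficients\<close>

lemma coeff_sum: "coeff (\<Sum>i\<in>A. f i) x = (\<Sum>i\<in>A. coeff (f i) x)"
  by (induction A rule: infinite_finite_induct) auto

lemma coeff_mult_of_nat: "coeff (f * of_nat k) x = of_nat k * coeff f x"
  by (induction k) (auto simp: algebra_simps)

lemma coeff_mult_of_int: "coeff (f * of_int k) x = of_int k * coeff f x"
  by (cases k rule: int_cases2) (auto simp: coeff_mult_of_nat)

lemma Val_K_eqI:
  assumes "coeff f v \<noteq> 0" "\<And>\<mu>. coeff f \<mu> \<noteq> 0 \<Longrightarrow> v \<le> \<mu>"
  shows "Val_K f = v"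
  unfolding Val_K_def using assms by (intro Least_equality) auto

text \<open>Only the two lowest exponents can add up to \<open>Val_K f + Val_K g\<close>, so the
  convolution has a single term.\<close>

lemma coeff_mult_Val_K:
  assumes "f \<noteq> 0" "g \<noteq> 0"
  shows "coeff (f * g) (Val_K f + Val_K g) = coeff f (Val_K f) * coeff g (Val_K g)"
proof -
  have "conv_supp f g (Val_K f + Val_K g) \<subseteq> {Val_K f}"
  proof
    fix a assume "a \<in> conv_supp f g (Val_K f + Val_K g)"
    then have "Val_K f \<le> a" "Val_K g \<le> Val_K f + Val_K g - a"
      using Val_K(2)[OF assms(1)] Val_K(2)[OF assms(2)] by (auto simp: conv_supp_def)
    then show "a \<in> {Val_K f}" by simp
  qed
  then show ?thesis by (subst coeff_mult_superset[of "{Val_K f}"]) auto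
qed

lemma Val_K_mult:
  assumes "f \<noteq> 0" "g \<noteq> 0"
  shows "Val_K (f * g) = Val_K f + Val_K g"
proof (rule Val_K_eqI)
  show "coeff (f * g) (Val_K f + Val_K g) \<noteq> 0"
    using Val_K(1)[OF assms(1)] Val_K(1)[OF assms(2)] coeff_mult_Val_K[OF assms] by simp
  show "Val_K f + Val_K g \<le> \<mu>" if nz: "coeff (f * g) \<mu> \<noteq> 0" for \<mu>
  proof -
    obtain a where "coeff f a \<noteq> 0" "coeff g (\<mu> - a) \<noteq> 0"
      using nz by (rule coeff_mult_nonzeroE)
    then show ?thesis
      using Val_K(2)[OF assms(1), of a] Val_K(2)[OF assms(2), of "\<mu> - a"] by simp
  qed
qed

lemma puiseux_pos_mult:
  assumes "f \<in> puiseux_pos" "g \<in> puiseux_pos"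
  shows "f * g \<in> puiseux_pos"
proof -
  obtain r s where rs: "r > 0" "coeff f (Val_K f) = complex_of_real r"
      "s > 0" "coeff g (Val_K g) = complex_of_real s"
    using assms by (auto simp: puiseux_pos_def)
  have nz: "f \<noteq> 0" "g \<noteq> 0" using assms by (auto simp: puiseux_pos_def)
  then have "coeff (f * g) (Val_K (f * g)) = complex_of_real (r * s)"
    by (simp add: Val_K_mult coeff_mult_Val_K rs)
  moreover have "r * s > 0" using rs by simp
  ultimately show ?thesis using nz unfolding puiseux_pos_def by auto
qed

section \<open>Tropically critical functionals\<close>

text \<open>
  The last clause is the valuation of an equation \<open>\<Sum> l(\<beta> w) g\<^sub>w = 0\<close> with positive
  \<open>g\<^sub>w\<close> of valuation \<open>\<Phi> w\<close>: its leading terms must cancel, so both signs of \<open>l(\<beta> w)\<close> occur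
  among them (replace \<open>l\<close> by \<open>-l\<close> for the other sign).
\<close>

definition tropically_critical ::
    "('v::euclidean_space \<Rightarrow> real) \<Rightarrow> ('u::euclidean_space, 'v) newton_data \<Rightarrow> bool" where
  "tropically_critical \<Phi> \<Xi> \<longleftrightarrow>
     newton_datum \<Xi> \<and> span (nd_beta \<Xi> ` nd_W \<Xi>) = nd_U \<Xi> \<and>
     linear \<Phi> \<and> (\<forall>c. \<Phi> (nd_eta \<Xi> c) = c) \<and>
     (\<forall>l :: 'u \<Rightarrow> real. linear l \<longrightarrow> (\<exists>w\<in>nd_W \<Xi>. l (nd_beta \<Xi> w) \<noteq> 0) \<longrightarrow>
       (\<exists>w\<in>nd_W \<Xi>. l (nd_beta \<Xi> w) < 0 \<and>
         (\<forall>w'\<in>nd_W \<Xi>. l (nd_beta \<Xi> w') \<noteq> 0 \<longrightarrow> \<Phi> w \<le> \<Phi> w')))"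

context
  fixes \<Phi> :: "'v::euclidean_space \<Rightarrow> real" and \<Xi> :: "('u::euclidean_space, 'v) newton_data"
  assumes crit: "tropically_critical \<Phi> \<Xi>"
begin

lemma crit_datum:
  shows "subspace (nd_U \<Xi>)" "subspace (nd_V \<Xi>)" "linear (nd_eta \<Xi>)" "linear (nd_beta \<Xi>)"
    "nd_beta \<Xi> ` nd_V \<Xi> = nd_U \<Xi>" "finite (nd_W \<Xi>)" "nd_W \<Xi> \<subseteq> nd_V \<Xi>"
    "x \<in> nd_V \<Xi> \<Longrightarrow> nd_beta \<Xi> x = 0 \<Longrightarrow> \<exists>c. x = nd_eta \<Xi> c"
    "nd_eta \<Xi> c \<in> nd_V \<Xi>" "nd_beta \<Xi> (nd_eta \<Xi> c) = 0"
  using crit unfolding tropically_critical_def newton_datum_def by blast+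

lemma crit_functional:
  shows "linear \<Phi>" "\<Phi> (nd_eta \<Xi> c) = c" "span (nd_beta \<Xi> ` nd_W \<Xi>) = nd_U \<Xi>"
  using crit unfolding tropically_critical_def by blast+

lemma crit_cancel:
  fixes l :: "'u \<Rightarrow> real"
  assumes "linear l" "w \<in> nd_W \<Xi>" "l (nd_beta \<Xi> w) \<noteq> 0"
  obtains w' where "w' \<in> nd_W \<Xi>" "l (nd_beta \<Xi> w') < 0"
    "\<And>w''. w'' \<in> nd_W \<Xi> \<Longrightarrow> l (nd_beta \<Xi> w'') \<noteq> 0 \<Longrightarrow> \<Phi> w' \<le> \<Phi> w''"
  using crit assms unfolding tropically_critical_def by blast

section \<open>The value \<open>nd_tau\<close> and the face through it\<close>

lemma finite_Wbar: "finite (nd_Wbar \<Xi>)"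
  using crit_datum(6) by (simp add: nd_Wbar_def)

lemma Delta_subset_V: "nd_Delta \<Xi> \<subseteq> nd_V \<Xi>"
  unfolding nd_Delta_def nd_Wbar_def using crit_datum(2,7)
  by (intro hull_minimal) (auto simp: subspace_imp_convex)

lemma Wbar_nonempty:
  assumes "dim (nd_U \<Xi>) > 0"
  shows "nd_Wbar \<Xi> \<noteq> {}"
proof
  assume "nd_Wbar \<Xi> = {}"
  then have "nd_beta \<Xi> ` nd_W \<Xi> \<subseteq> {0}" by (auto simp: nd_Wbar_def)
  then have "nd_U \<Xi> \<subseteq> {0}"
    using crit_functional(3) span_mono[of "nd_beta \<Xi> ` nd_W \<Xi>" "{0}"] by (simp add: span_insert_0)
  then show False using assms by (metis dim_eq_0 less_irrefl)
qed

text \<open>By separation, \<open>0\<close> lies in the convex hull of the images of the minimisers of \<open>\<Phi>\<close>.\<close>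

lemma tau_minimum:
  assumes "dim (nd_U \<Xi>) > 0"
  shows "nd_eta \<Xi> (nd_tau \<Xi>) \<in> nd_Delta \<Xi>" "x \<in> nd_Delta \<Xi> \<Longrightarrow> nd_tau \<Xi> \<le> \<Phi> x"
proof -
  define \<mu> where "\<mu> = Min (\<Phi> ` nd_Wbar \<Xi>)"
  define S where "S = {w \<in> nd_Wbar \<Xi>. \<Phi> w = \<mu>}"
  note fin = finite_Wbar and ne = Wbar_nonempty[OF assms]
  have "\<mu> \<in> \<Phi> ` nd_Wbar \<Xi>" unfolding \<mu>_def using fin ne by (intro Min_in) auto
  then obtain w0 where w0: "w0 \<in> S" unfolding S_def by auto
  have \<mu>_le: "\<mu> \<le> \<Phi> w" if "w \<in> nd_Wbar \<Xi>" for w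
    unfolding \<mu>_def using fin that by simp
  have "convex {x. \<mu> \<le> \<Phi> x}"
    using convex_linear_vimage[OF crit_functional(1) convex_real_interval(1), of \<mu>]
    by (simp add: vimage_def)
  then have "nd_Delta \<Xi> \<subseteq> {x. \<mu> \<le> \<Phi> x}"
    unfolding nd_Delta_def using \<mu>_le by (intro hull_minimal) auto
  then have lower: "\<mu> \<le> \<Phi> x" if "x \<in> nd_Delta \<Xi>" for x using that by blast
  have "0 \<in> convex hull (nd_beta \<Xi> ` S)"
  proof (rule ccontr)
    assume not_in: "0 \<notin> convex hull (nd_beta \<Xi> ` S)"
    have "finite S" using fin by (simp add: S_def)
    then have "closed (convex hull (nd_beta \<Xi> ` S))"
      by (simp add: finite_imp_compact_convex_hull compact_imp_closed)
    then obtain a b where ab: "0 < b" "\<And>x. x \<in> convex hull (nd_beta \<Xi> ` S) \<Longrightarrow> a \<bullet> x > b"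
      using separating_hyperplane_closed_0[OF convex_convex_hull _ not_in] by blast
    then have pos: "a \<bullet> nd_beta \<Xi> w > 0" if "w \<in> S" for w
      using that by (meson hull_inc imageI less_trans)
    have w0W: "w0 \<in> nd_W \<Xi>" using w0 by (simp add: S_def nd_Wbar_def)
    have "linear (\<lambda>x. a \<bullet> x)" by (simp add: bounded_linear.linear bounded_linear_inner_right)
    \<comment> \<open>Cancellation for \<open>a\<close> yields a vector on its negative side with
      \<open>\<Phi> w \<le> \<Phi> w0 = \<mu>\<close>. It is therefore a minimiser, although
      \<open>a\<close> is positive on the image of \<open>S\<close>.\<close>
    then obtain w where w: "w \<in> nd_W \<Xi>" "a \<bullet> nd_beta \<Xi> w < 0"
        "\<And>w'. w' \<in> nd_W \<Xi> \<Longrightarrow> a \<bullet> nd_beta \<Xi> w' \<noteq> 0 \<Longrightarrow> \<Phi> w \<le> \<Phi> w'"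
      using crit_cancel[of "\<lambda>x. a \<bullet> x" w0] w0W pos[OF w0] by (metis less_irrefl)
    have "w \<in> nd_Wbar \<Xi>" using w by (auto simp: nd_Wbar_def)
    moreover have "\<Phi> w \<le> \<mu>" using w(3)[OF w0W] pos[OF w0] w0 by (simp add: S_def)
    ultimately have "w \<in> S" using \<mu>_le by (force simp: S_def)
    then show False using pos w(2) by fastforce
  qed
  \<comment> \<open>The same convex combination, taken in \<open>nd_V\<close>, lies over 0 and hence
    on the line \<open>range (nd_eta \<Xi>)\<close>; its value under \<Phi> identifies it as
    \<open>nd_eta \<Xi> \<mu>\<close>.\<close>
  then obtain x where x: "x \<in> convex hull S" "nd_beta \<Xi> x = 0"
    by (metis crit_datum(4) convex_hull_linear_image imageE)
  have "convex {x. \<Phi> x = \<mu>}"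
    using convex_linear_vimage[OF crit_functional(1) convex_singleton, of \<mu>]
    by (simp add: vimage_def)
  then have "convex hull S \<subseteq> {x. \<Phi> x = \<mu>}"
    by (intro hull_minimal) (auto simp: S_def)
  then have \<Phi>x: "\<Phi> x = \<mu>" using x by blast
  have x\<Delta>: "x \<in> nd_Delta \<Xi>"
    using x(1) hull_mono[of S "nd_Wbar \<Xi>" convex] by (auto simp: nd_Delta_def S_def)
  then obtain c where "x = nd_eta \<Xi> c"
    using crit_datum(8) Delta_subset_V x(2) by blast
  then have eta: "nd_eta \<Xi> \<mu> \<in> nd_Delta \<Xi>"
    using \<Phi>x x\<Delta> crit_functional(2) by simp
  \<comment> \<open>On this line \<Phi> is the parameter, so the lower bound on
    \<open>nd_Delta\<close> makes \<mu> the least parameter; being attained, it is the value of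
    \<open>LEAST\<close>.\<close>
  moreover have "\<mu> \<le> c" if "nd_eta \<Xi> c \<in> nd_Delta \<Xi>" for c
    using lower[OF that] crit_functional(2) by simp
  ultimately have "nd_tau \<Xi> = \<mu>"
    unfolding nd_tau_def by (intro Least_equality) auto
  then show "nd_eta \<Xi> (nd_tau \<Xi>) \<in> nd_Delta \<Xi>" "x \<in> nd_Delta \<Xi> \<Longrightarrow> nd_tau \<Xi> \<le> \<Phi> x" for x
    using eta lower by auto
qed

text \<open>Since \<Phi> is at least \<tau> on \<open>nd_Delta\<close>, its level set at \<tau> cuts
  out a face through the point on the line, and the minimal face lies inside it. As
  \<open>nd_face\<close> admits the whole polytope only when it is not full-dimensional, the case
  that the level set contains all of \<open>nd_Delta\<close> needs a dimension count.\<close>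

lemma face_props:
  assumes "dim (nd_U \<Xi>) > 0"
  shows "nd_face \<Xi> face_of nd_Delta \<Xi>" "nd_eta \<Xi> (nd_tau \<Xi>) \<in> nd_face \<Xi>"
    "x \<in> nd_face \<Xi> \<Longrightarrow> \<Phi> x = nd_tau \<Xi>"
proof -
  define \<T> where "\<T> = {F. F face_of nd_Delta \<Xi> \<and> nd_eta \<Xi> (nd_tau \<Xi>) \<in> F \<and>
           (F = nd_Delta \<Xi> \<longrightarrow> aff_dim (nd_Delta \<Xi>) < int (dim (nd_V \<Xi>)))}"
  \<comment> \<open>The vector representing \<Phi> as an inner product, the form in which supporting
    hyperplanes are given.\<close>
  define a where "a = adjoint \<Phi> 1"
  have \<Phi>: "\<Phi> x = a \<bullet> x" for x
    using adjoint_works[OF crit_functional(1), of x 1] by (simp add: a_def inner_commute)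
  define G where "G = nd_Delta \<Xi> \<inter> {x. a \<bullet> x = nd_tau \<Xi>}"
  have "G face_of nd_Delta \<Xi>"
    unfolding G_def using tau_minimum(2)[OF assms] \<Phi>
    by (intro face_of_Int_supporting_hyperplane_ge) (auto simp: nd_Delta_def)
  moreover have "nd_eta \<Xi> (nd_tau \<Xi>) \<in> G"
    using tau_minimum(1)[OF assms] crit_functional(2) by (simp add: G_def \<Phi>[symmetric])
  moreover have "aff_dim (nd_Delta \<Xi>) < int (dim (nd_V \<Xi>))" if "G = nd_Delta \<Xi>"
  proof -
    text \<open>\<open>\<Delta>\<close> lies in the translate by \<open>\<eta>(\<tau>)\<close> of the proper subspace \<open>V \<inter> ker \<Phi>\<close>.\<close>
    let ?e = "nd_eta \<Xi> (nd_tau \<Xi>)"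
    let ?K = "{x \<in> nd_V \<Xi>. \<Phi> x = 0}"
    have K: "subspace ?K"
      using crit_datum(2) crit_functional(1)
      by (auto simp: subspace_def linear_0 linear_add linear_scale)
    have "(\<lambda>x. - ?e + x) ` nd_Delta \<Xi> \<subseteq> ?K"
    proof
      fix y assume "y \<in> (\<lambda>x. - ?e + x) ` nd_Delta \<Xi>"
      then obtain x where x: "x \<in> nd_Delta \<Xi>" "y = x - ?e" by auto
      then have "\<Phi> x = nd_tau \<Xi>" using that \<Phi> unfolding G_def by auto
      then show "y \<in> ?K"
        using x Delta_subset_V crit_datum(2,9) crit_functional(1,2)
        by (auto simp: linear_diff intro: subspace_diff)
    qed
    then have "aff_dim (nd_Delta \<Xi>) \<le> aff_dim ?K"
      by (metis aff_dim_subset aff_dim_translation_eq)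
    also have "\<dots> = int (dim ?K)" using K by (rule aff_dim_subspace)
    also have "dim ?K < dim (nd_V \<Xi>)"
    proof (rule dim_psubset)
      \<comment> \<open>The inclusion is strict because \<open>nd_eta \<Xi> 1\<close> lies in
        \<open>nd_V\<close> and \<Phi> is 1 there.\<close>
      have "nd_eta \<Xi> 1 \<in> nd_V \<Xi>" "\<Phi> (nd_eta \<Xi> 1) \<noteq> 0"
        using crit_datum(9) crit_functional(2) by auto
      then show "span ?K \<subset> span (nd_V \<Xi>)"
        using K crit_datum(2) by (auto simp: span_eq_iff[THEN iffD2])
    qed
    finally show ?thesis by simp
  qed
  ultimately have G: "G \<in> \<T>" by (auto simp: \<T>_def)
  have F: "nd_face \<Xi> = \<Inter>\<T>" by (simp add: nd_face_def \<T>_def)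
  show "nd_face \<Xi> face_of nd_Delta \<Xi>"
    unfolding F using G by (intro face_of_Inter) (auto simp: \<T>_def)
  show "nd_eta \<Xi> (nd_tau \<Xi>) \<in> nd_face \<Xi>"
    unfolding F by (auto simp: \<T>_def)
  show "\<Phi> x = nd_tau \<Xi>" if "x \<in> nd_face \<Xi>"
    using that G unfolding F by (auto simp: G_def \<Phi>)
qed

section \<open>The quotient by \<open>nd_E\<close>\<close>

lemma subspace_E: "subspace (nd_E \<Xi>)" "subspace (nd_beta \<Xi> ` nd_E \<Xi>)"
  using linear_subspace_image[OF crit_datum(4)] by (auto simp: nd_E_def)

text \<open>The face sits at the single level \<tau> of \<Phi>, so \<Phi> kills the differences
  spanning \<open>nd_E\<close>. This is what lets \<Phi> descend to the quotient.\<close>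

lemma E_subset:
  assumes "dim (nd_U \<Xi>) > 0"
  shows "nd_E \<Xi> \<subseteq> {x \<in> nd_V \<Xi>. \<Phi> x = 0}"
  unfolding nd_E_def
proof (rule span_minimal)
  show "subspace {x \<in> nd_V \<Xi>. \<Phi> x = 0}"
    using crit_datum(2) crit_functional(1)
    by (auto simp: subspace_def linear_0 linear_add linear_scale)
  show "(\<lambda>x. x - nd_eta \<Xi> (nd_tau \<Xi>)) ` nd_face \<Xi> \<subseteq> {x \<in> nd_V \<Xi>. \<Phi> x = 0}"
  proof (intro image_subsetI CollectI conjI)
    fix x assume x: "x \<in> nd_face \<Xi>"
    then have "x \<in> nd_V \<Xi>"
      using face_of_imp_subset[OF face_props(1)[OF assms]] Delta_subset_V by blast
    then show "x - nd_eta \<Xi> (nd_tau \<Xi>) \<in> nd_V \<Xi>"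
      using crit_datum(2,9) by (simp add: subspace_diff)
    show "\<Phi> (x - nd_eta \<Xi> (nd_tau \<Xi>)) = 0"
      using face_props(3)[OF assms x] crit_functional(1,2) by (simp add: linear_diff)
  qed
qed

text \<open>This forces the dimension to drop. A one-point face would be a vertex of
  \<open>nd_Delta\<close>, hence a member of \<open>nd_Wbar\<close>, although \<open>nd_beta\<close>
  kills it. So \<open>nd_E\<close> contains a nonzero vector; \<open>nd_beta\<close> cannot kill it,
  because \<Phi> vanishes on \<open>nd_E\<close> but is the parameter on the kernel line.\<close>

lemma beta_E_nontrivial:
  assumes "dim (nd_U \<Xi>) > 0"
  obtains e where "e \<in> nd_beta \<Xi> ` nd_E \<Xi>" "e \<noteq> 0"
proof (cases "nd_face \<Xi> = {nd_eta \<Xi> (nd_tau \<Xi>)}")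
  case True
  then have "nd_eta \<Xi> (nd_tau \<Xi>) extreme_point_of convex hull (nd_Wbar \<Xi>)"
    using face_props(1)[OF assms] by (simp add: face_of_singleton nd_Delta_def)
  then have "nd_eta \<Xi> (nd_tau \<Xi>) \<in> nd_Wbar \<Xi>"
    by (rule extreme_point_of_convex_hull)
  then show ?thesis using crit_datum(10) by (simp add: nd_Wbar_def)
next
  case False
  then obtain x where x: "x \<in> nd_face \<Xi>" "x \<noteq> nd_eta \<Xi> (nd_tau \<Xi>)"
    using face_props(2)[OF assms] by blast
  let ?y = "x - nd_eta \<Xi> (nd_tau \<Xi>)"
  have y: "?y \<in> nd_E \<Xi>" unfolding nd_E_def using x(1) by (intro span_base) auto
  have "nd_beta \<Xi> ?y \<noteq> 0"
  proof
    assume "nd_beta \<Xi> ?y = 0"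
    then obtain c where c: "?y = nd_eta \<Xi> c"
      using crit_datum(8) y E_subset[OF assms] by blast
    then have "c = 0" using y E_subset[OF assms] crit_functional(2) by force
    then show False using c x(2) crit_datum(3) by (simp add: linear_0)
  qed
  then show ?thesis using that y by blast
qed

text \<open>A vector and its representative differ by an element of \<open>nd_E\<close>, where
  \<Phi> vanishes. As representatives stay in the same type, one function \<Phi> serves at every
  stage of the recursion.\<close>

lemma Phi_sigma:
  assumes "dim (nd_U \<Xi>) > 0"
  shows "\<Phi> (nd_sigma \<Xi> x) = \<Phi> x"
proof -
  have "x - nd_sigma \<Xi> x \<in> nd_E \<Xi>"
    unfolding nd_sigma_def using subspace_E(1) by (rule coset_rep(1))
  then have "\<Phi> (x - nd_sigma \<Xi> x) = 0" using E_subset[OF assms] by blast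
  then show ?thesis using crit_functional(1) by (simp add: linear_diff)
qed

text \<open>The representatives are vectors of \<open>nd_U\<close> orthogonal to the image of
  \<open>nd_E\<close>, so they miss a nonzero vector of that image.\<close>

lemma dim_step_less:
  assumes "dim (nd_U \<Xi>) > 0"
  shows "dim (nd_U (nd_step \<Xi>)) < dim (nd_U \<Xi>)"
proof -
  let ?B = "nd_beta \<Xi> ` nd_E \<Xi>"
  have B: "?B \<subseteq> nd_U \<Xi>" using E_subset[OF assms] crit_datum(5) by blast
  obtain e where e: "e \<in> ?B" "e \<noteq> 0" using beta_E_nontrivial[OF assms] .
  have "nd_rho \<Xi> ` nd_U \<Xi> \<subseteq> nd_U \<Xi>"
  proof
    fix y assume "y \<in> nd_rho \<Xi> ` nd_U \<Xi>"
    then obtain x where x: "x \<in> nd_U \<Xi>" "y = nd_rho \<Xi> x" by blast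
    have "x - y \<in> nd_U \<Xi>"
      using coset_rep(1)[OF subspace_E(2), of x] B x(2) by (auto simp: nd_rho_def)
    from subspace_diff[OF crit_datum(1) x(1) this] show "y \<in> nd_U \<Xi>" by simp
  qed
  moreover have "e \<notin> nd_rho \<Xi> ` nd_U \<Xi>"
    using coset_rep(2)[OF subspace_E(2) e(1)] e(2) orthogonal_self[of e]
    by (metis imageE nd_rho_def)
  moreover have "e \<in> nd_U \<Xi>" using e B by blast
  moreover have "subspace (nd_rho \<Xi> ` nd_U \<Xi>)"
    unfolding nd_rho_def
    using linear_coset_rep[OF subspace_E(2)] crit_datum(1) by (rule linear_subspace_image)
  ultimately show ?thesis
    using crit_datum(1) unfolding nd_step_def newton_data.simps
    by (intro dim_psubset) (auto simp: span_eq_iff[THEN iffD2])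
qed

text \<open>A functional \<open>l\<close> on the quotient pulls back to
  \<open>l \<circ> nd_rho \<Xi>\<close>, so its cancellation condition is an instance of the old
  one. The vectors over 0 may be dropped because every linear functional vanishes on their
  image.\<close>

lemma tropically_critical_step:
  assumes "dim (nd_U \<Xi>) > 0"
  shows "tropically_critical \<Phi> (nd_step \<Xi>)"
proof -
  let ?\<sigma> = "nd_sigma \<Xi>" and ?\<rho> = "nd_rho \<Xi>" and ?\<beta> = "nd_beta \<Xi>" and ?\<eta> = "nd_eta \<Xi>"
  have \<sigma>: "linear ?\<sigma>" unfolding nd_sigma_def by (rule linear_coset_rep[OF subspace_E(1)])
  have \<rho>: "linear ?\<rho>" unfolding nd_rho_def by (rule linear_coset_rep[OF subspace_E(2)])
  have sel: "nd_U (nd_step \<Xi>) = ?\<rho> ` nd_U \<Xi>" "nd_V (nd_step \<Xi>) = ?\<sigma> ` nd_V \<Xi>"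
    "nd_eta (nd_step \<Xi>) = ?\<sigma> \<circ> ?\<eta>" "nd_beta (nd_step \<Xi>) = ?\<rho> \<circ> ?\<beta>"
    "nd_W (nd_step \<Xi>) = ?\<sigma> ` nd_Wbar \<Xi>"
    by (simp_all add: nd_step_def)
  have \<beta>\<sigma>: "?\<rho> (?\<beta> (?\<sigma> x)) = ?\<rho> (?\<beta> x)" for x
    using nd_step_beta_induced[OF crit_datum(4), of x] by (simp add: sel)
  note \<Phi>\<sigma> = Phi_sigma[OF assms]
  have eta': "\<Phi> (?\<sigma> (?\<eta> c)) = c" for c using \<Phi>\<sigma> crit_functional(2) by simp
  have exact: "{x \<in> ?\<sigma> ` nd_V \<Xi>. ?\<rho> (?\<beta> x) = 0} = range (?\<sigma> \<circ> ?\<eta>)"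
  proof (intro subset_antisym subsetI)
    fix x assume "x \<in> {x \<in> ?\<sigma> ` nd_V \<Xi>. ?\<rho> (?\<beta> x) = 0}"
    then obtain y where y: "y \<in> nd_V \<Xi>" "x = ?\<sigma> y" "?\<rho> (?\<beta> y) = 0" using \<beta>\<sigma> by auto
    then have "?\<beta> y \<in> ?\<beta> ` nd_E \<Xi>"
      using coset_rep_eq_0_iff[OF subspace_E(2)] by (simp add: nd_rho_def)
    then obtain e where e: "e \<in> nd_E \<Xi>" "?\<beta> y = ?\<beta> e" by blast
    \<comment> \<open>Subtracting \<open>e\<close> moves \<open>y\<close> into the kernel of
      \<open>nd_beta\<close> without changing its class.\<close>
    then have "y - e \<in> nd_V \<Xi>" "?\<beta> (y - e) = 0"
      using y(1) E_subset[OF assms] crit_datum(2,4) by (auto simp: linear_diff intro: subspace_diff)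
    then obtain c where "y - e = ?\<eta> c" using crit_datum(8) by blast
    moreover have "?\<sigma> e = 0"
      using e(1) coset_rep_eq_0_iff[OF subspace_E(1)] by (simp add: nd_sigma_def)
    ultimately have "x = ?\<sigma> (?\<eta> c)" using y(2) \<sigma> by (metis linear_diff diff_zero)
    then show "x \<in> range (?\<sigma> \<circ> ?\<eta>)" by simp
  next
    fix x assume "x \<in> range (?\<sigma> \<circ> ?\<eta>)"
    then show "x \<in> {x \<in> ?\<sigma> ` nd_V \<Xi>. ?\<rho> (?\<beta> x) = 0}"
      using crit_datum(9,10) \<beta>\<sigma> \<rho> by (auto simp: linear_0)
  qed
  have surj: "(?\<rho> \<circ> ?\<beta>) ` ?\<sigma> ` nd_V \<Xi> = ?\<rho> ` nd_U \<Xi>"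
    unfolding crit_datum(5)[symmetric] by (simp add: image_image \<beta>\<sigma>)
  have "newton_datum (nd_step \<Xi>)"
    unfolding newton_datum_def sel
  proof (intro conjI)
    \<comment> \<open>\<Phi> is a left inverse of the new \<open>nd_eta\<close>.\<close>
    show "inj (?\<sigma> \<circ> ?\<eta>)" using eta' by (intro injI) (metis comp_apply)
    show "?\<sigma> ` nd_Wbar \<Xi> \<subseteq> ?\<sigma> ` nd_V \<Xi>" using crit_datum(7) by (auto simp: nd_Wbar_def)
  qed (use \<sigma> \<rho> crit_datum exact surj finite_Wbar in
      \<open>auto intro: linear_subspace_image linear_compose\<close>)
  moreover have "span ((?\<rho> \<circ> ?\<beta>) ` ?\<sigma> ` nd_Wbar \<Xi>) = ?\<rho> ` nd_U \<Xi>"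
  proof -
    have "?\<beta> ` nd_Wbar \<Xi> = ?\<beta> ` nd_W \<Xi> - {0}" by (auto simp: nd_Wbar_def)
    then have "span (?\<beta> ` nd_Wbar \<Xi>) = nd_U \<Xi>" using crit_functional(3) by simp
    moreover have "(?\<rho> \<circ> ?\<beta>) ` ?\<sigma> ` nd_Wbar \<Xi> = ?\<rho> ` ?\<beta> ` nd_Wbar \<Xi>"
      by (simp add: image_image \<beta>\<sigma>)
    ultimately show ?thesis using linear_span_image[OF \<rho>] by simp
  qed
  moreover have "\<exists>w\<in>?\<sigma> ` nd_Wbar \<Xi>. l ((?\<rho> \<circ> ?\<beta>) w) < 0 \<and>
      (\<forall>w'\<in>?\<sigma> ` nd_Wbar \<Xi>. l ((?\<rho> \<circ> ?\<beta>) w') \<noteq> 0 \<longrightarrow> \<Phi> w \<le> \<Phi> w')"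
    if l: "linear l" and ex: "\<exists>w\<in>?\<sigma> ` nd_Wbar \<Xi>. l ((?\<rho> \<circ> ?\<beta>) w) \<noteq> 0" for l :: "'u \<Rightarrow> real"
  proof -
    have lin: "linear (l \<circ> ?\<rho>)" using \<rho> l by (rule linear_compose)
    from ex obtain w0 where w0: "w0 \<in> nd_W \<Xi>" "(l \<circ> ?\<rho>) (?\<beta> w0) \<noteq> 0"
      by (auto simp: \<beta>\<sigma> nd_Wbar_def)
    obtain w where w: "w \<in> nd_W \<Xi>" "(l \<circ> ?\<rho>) (?\<beta> w) < 0"
      "\<And>w'. w' \<in> nd_W \<Xi> \<Longrightarrow> (l \<circ> ?\<rho>) (?\<beta> w') \<noteq> 0 \<Longrightarrow> \<Phi> w \<le> \<Phi> w'"
      using crit_cancel[OF lin w0] by blast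
    have "w \<in> nd_Wbar \<Xi>" using w(1,2) lin by (auto simp: nd_Wbar_def dest: linear_0)
    then show ?thesis
      using w by (intro bexI[of _ "?\<sigma> w"]) (auto simp: \<beta>\<sigma> \<Phi>\<sigma> nd_Wbar_def)
  qed
  ultimately show ?thesis
    unfolding tropically_critical_def sel using crit_functional(1) eta' by simp
qed

end

section \<open>Iterating the recursion step\<close>

text \<open>Each step costs at least one dimension, so the second clause bounds the number of steps;
  the third transports \<Phi> along the composed projections to the final datum.\<close>

lemma tropically_critical_iter:
  assumes "tropically_critical \<Phi> \<Xi>" "\<And>j. j < k \<Longrightarrow> dim (nd_U (nd_iter \<Xi> j)) > 0"
  shows "tropically_critical \<Phi> (nd_iter \<Xi> k) \<and> dim (nd_U (nd_iter \<Xi> k)) + k \<le> dim (nd_U \<Xi>) \<and>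
    (\<forall>x\<in>nd_V \<Xi>. nd_proj \<Xi> k x \<in> nd_V (nd_iter \<Xi> k) \<and> \<Phi> (nd_proj \<Xi> k x) = \<Phi> x)"
  using assms(2)
proof (induction k)
  case 0
  then show ?case using assms(1) by (simp add: nd_iter_def)
next
  case (Suc k)
  have step: "nd_iter \<Xi> (Suc k) = nd_step (nd_iter \<Xi> k)" by (simp add: nd_iter_def)
  have pos: "dim (nd_U (nd_iter \<Xi> k)) > 0" using Suc.prems by simp
  have IH: "tropically_critical \<Phi> (nd_iter \<Xi> k)" "dim (nd_U (nd_iter \<Xi> k)) + k \<le> dim (nd_U \<Xi>)"
    "\<forall>x\<in>nd_V \<Xi>. nd_proj \<Xi> k x \<in> nd_V (nd_iter \<Xi> k) \<and> \<Phi> (nd_proj \<Xi> k x) = \<Phi> x"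
    using Suc by auto
  have "nd_V (nd_iter \<Xi> (Suc k)) = nd_sigma (nd_iter \<Xi> k) ` nd_V (nd_iter \<Xi> k)"
    by (simp add: step nd_step_def)
  then show ?case
    using tropically_critical_step[OF IH(1) pos] dim_step_less[OF IH(1) pos] IH(2,3)
      Phi_sigma[OF IH(1) pos]
    by (auto simp: step)
qed

text \<open>At the terminal stage \<open>nd_U\<close> is zero, so every vector of
  \<open>nd_V\<close> lies on the line of \<open>nd_eta\<close> and \<Phi> reads off its parameter.
  The projections preserve \<Phi>, so this parameter is the value of \<Phi> at the original
  vector.\<close>

theorem tropically_critical_unique:
  assumes "tropically_critical \<Phi> \<Xi>"
  shows "d_crit_tilde \<Xi> = restrict \<Phi> (nd_V \<Xi>)"
proof -
  have ex: "\<exists>k. dim (nd_U (nd_iter \<Xi> k)) = 0"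
  proof (rule ccontr)
    assume "\<not> ?thesis"
    then have "dim (nd_U (nd_iter \<Xi> k)) > 0" for k by (simp del: dim_eq_0)
    \<comment> \<open>Without termination, \<open>Suc (dim (nd_U \<Xi>))\<close> steps would use up
      more than the available dimension.\<close>
    then show False
      using tropically_critical_iter[OF assms, of "Suc (dim (nd_U \<Xi>))"] by fastforce
  qed
  define m where "m = nd_last \<Xi>"
  have m: "dim (nd_U (nd_iter \<Xi> m)) = 0"
    unfolding m_def nd_last_def using ex by (rule LeastI_ex)
  have "dim (nd_U (nd_iter \<Xi> j)) > 0" if "j < m" for j
    using not_less_Least that unfolding m_def nd_last_def by blast
  note iter = tropically_critical_iter[OF assms this]
  then have crit: "tropically_critical \<Phi> (nd_iter \<Xi> m)" by blast
  let ?\<eta> = "nd_eta (nd_iter \<Xi> m)"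
  have "inv ?\<eta> (nd_proj \<Xi> m x) = \<Phi> x" if x: "x \<in> nd_V \<Xi>" for x
  proof -
    let ?y = "nd_proj \<Xi> m x"
    have y: "?y \<in> nd_V (nd_iter \<Xi> m)" "\<Phi> ?y = \<Phi> x" using iter x by blast+
    have "nd_beta (nd_iter \<Xi> m) ?y \<in> nd_U (nd_iter \<Xi> m)"
      using y(1) crit_datum(5)[OF crit] by blast
    then have "nd_beta (nd_iter \<Xi> m) ?y = 0" using m by (metis dim_eq_0 singletonD subsetD)
    then obtain c where "?y = ?\<eta> c" using crit_datum(8)[OF crit y(1)] by blast
    then have "?\<eta> (inv ?\<eta> ?y) = ?y" by (metis f_inv_into_f rangeI)
    then show ?thesis using crit_functional(2)[OF crit] y(2) by metis
  qed
  then show ?thesis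
    unfolding d_crit_tilde_def m_def[symmetric] by (intro restrict_ext) simp
qed

section \<open>Lattices\<close>

text \<open>The generators in the definition of a lattice are independent, so they serve as
  \<open>B\<close>, and the integer coefficients of a lattice vector are its coordinates.\<close>

lemma lattice_basis:
  assumes "is_lattice M"
  obtains B where "independent B" "finite B" "B \<subseteq> M" "span B = span M" "0 \<in> M"
    "\<And>x y. x \<in> M \<Longrightarrow> y \<in> M \<Longrightarrow> x + y \<in> M" "\<And>x. x \<in> M \<Longrightarrow> - x \<in> M"
    "\<And>x b. x \<in> M \<Longrightarrow> representation B x b \<in> \<int>"
proof -
  obtain B where B: "independent B" and M: "M = {\<Sum>b\<in>B. real_of_int (k b) *\<^sub>R b | k. True}"
    using assms unfolding is_lattice_def by blast
  have fin: "finite B" using B by (rule independent_imp_finite)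
  have BM: "B \<subseteq> M"
  proof
    fix b assume "b \<in> B"
    then have "b = (\<Sum>c\<in>B. real_of_int (if c = b then 1 else 0) *\<^sub>R c)"
      using fin by (simp add: if_distrib[of "\<lambda>k. real_of_int k *\<^sub>R _"] if_distribR cong: if_cong)
    then show "b \<in> M" unfolding M by (intro CollectI exI[of _ "\<lambda>c. if c = b then 1 else 0"]) simp
  qed
  have "M \<subseteq> span B" unfolding M by (auto intro: span_sum span_scale span_base)
  then have sp: "span B = span M" using BM by (metis span_eq span_superset subset_trans)
  have zero: "0 \<in> M" unfolding M by (intro CollectI exI[of _ "\<lambda>_. 0"]) simp
  have add: "x + y \<in> M" if xy: "x \<in> M" "y \<in> M" for x y
  proof -
    obtain k j where "x = (\<Sum>b\<in>B. real_of_int (k b) *\<^sub>R b)" "y = (\<Sum>b\<in>B. real_of_int (j b) *\<^sub>R b)"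
      using xy unfolding M by blast
    then have "x + y = (\<Sum>b\<in>B. real_of_int (k b + j b) *\<^sub>R b)"
      by (simp add: sum.distrib algebra_simps)
    then show ?thesis unfolding M by (intro CollectI exI[of _ "\<lambda>b. k b + j b"]) simp
  qed
  have neg: "- x \<in> M" if x: "x \<in> M" for x
  proof -
    obtain k where "x = (\<Sum>b\<in>B. real_of_int (k b) *\<^sub>R b)"
      using x unfolding M by blast
    then have "- x = (\<Sum>b\<in>B. real_of_int (- k b) *\<^sub>R b)" by (simp add: sum_negf)
    then show ?thesis unfolding M by (intro CollectI exI[of _ "\<lambda>b. - k b"]) simp
  qed
  have rep: "representation B x b \<in> \<int>" if x: "x \<in> M" for x b
  proof (cases "b \<in> B")
    case True
    obtain k where k: "x = (\<Sum>b\<in>B. real_of_int (k b) *\<^sub>R b)"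
      using x unfolding M by blast
    have "representation B x b = (\<Sum>c\<in>B. real_of_int (k c) * representation B c b)"
      unfolding k using B
      by (subst representation_sum) (auto simp: representation_scale span_base span_scale)
    also have "\<dots> \<in> \<int>"
      using B by (intro Ints_sum Ints_mult Ints_of_int) (simp add: representation_basis)
    finally show ?thesis .
  next
    case False
    then have "representation B x b = 0" using representation_ne_zero by blast
    then show ?thesis by simp
  qed
  show ?thesis using that B fin BM sp zero add neg rep by blast
qed


text \<open>\<phi> is prescribed by the values of \<open>f\<close> on a lattice basis. The error
  \<open>d\<close> is additive on \<open>M\<close> and zero on the basis, hence zero on natural
  multiples, then on integer multiples, then on integral combinations.\<close>

lemma additive_linear_extension:
  fixes f :: "'a::euclidean_space \<Rightarrow> real"
  assumes M: "is_lattice M" and f: "\<And>x y. x \<in> M \<Longrightarrow> y \<in> M \<Longrightarrow> f (x + y) = f x + f y"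
  obtains \<phi> where "linear \<phi>" "\<And>x. x \<in> M \<Longrightarrow> f x = \<phi> x"
proof -
  obtain B where B: "independent B" "finite B" "B \<subseteq> M" "span B = span M" "0 \<in> M"
    "\<And>x y. x \<in> M \<Longrightarrow> y \<in> M \<Longrightarrow> x + y \<in> M" "\<And>x. x \<in> M \<Longrightarrow> - x \<in> M"
    "\<And>x b. x \<in> M \<Longrightarrow> representation B x b \<in> \<int>"
    using lattice_basis[OF M] by blast
  obtain \<phi> where \<phi>: "linear \<phi>" "\<forall>b\<in>B. \<phi> b = f b"
    using linear_independent_extend[OF B(1)] by blast
  define d where "d x = f x - \<phi> x" for x
  have d_add: "d (x + y) = d x + d y" if "x \<in> M" "y \<in> M" for x y
    using f[OF that] \<phi>(1) by (simp add: d_def linear_add)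
  have d0: "d 0 = 0" using d_add[OF B(5) B(5)] by simp
  have d_neg: "d (- x) = - d x" if "x \<in> M" for x
    using d_add[OF that B(7)[OF that]] d0 by simp
  \<comment> \<open>Membership in \<open>M\<close> is carried along because \<open>d\<close> is
    known to be additive only there.\<close>
  have d_nat: "real n *\<^sub>R b \<in> M \<and> d (real n *\<^sub>R b) = 0" if "b \<in> B" for n b
  proof (induction n)
    case (Suc n)
    have "b \<in> M" "d b = 0" using that B(3) \<phi>(2) by (auto simp: d_def)
    then show ?case using Suc B(6) d_add by (simp add: scaleR_add_left)
  qed (use d0 B(5) in simp)
  have d_int: "real_of_int k *\<^sub>R b \<in> M \<and> d (real_of_int k *\<^sub>R b) = 0" if "b \<in> B" for k b
  proof (cases k rule: int_cases2)
    case (nonneg n)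
    then show ?thesis using d_nat[OF that] by simp
  next
    case (nonpos n)
    then show ?thesis using d_nat[OF that, of n] B(7) d_neg by fastforce
  qed
  have d_sum: "(\<Sum>b\<in>S. real_of_int (k b) *\<^sub>R b) \<in> M \<and> d (\<Sum>b\<in>S. real_of_int (k b) *\<^sub>R b) = 0"
    if "S \<subseteq> B" for S k
    using finite_subset[OF that B(2)] that
  proof (induction S)
    case (insert b S)
    then show ?case using d_int[of b "k b"] B(6) d_add by simp
  qed (use d0 B(5) in simp)
  have "f x = \<phi> x" if "x \<in> M" for x
  proof -
    have "x \<in> span B" using that B(4) by (simp add: span_base)
    then have "x = (\<Sum>b\<in>B. representation B x b *\<^sub>R b)"
      using B(1,2) by (simp add: sum_representation_eq)
    also have "\<dots> = (\<Sum>b\<in>B. real_of_int \<lfloor>representation B x b\<rfloor> *\<^sub>R b)"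
      using B(8)[OF that] by simp
    finally show ?thesis
      using d_sum[of B "\<lambda>b. \<lfloor>representation B x b\<rfloor>"] by (simp add: d_def)
  qed
  then show ?thesis using that \<phi>(1) by blast
qed

text \<open>The vectors on which both functionals agree form a subspace containing \<open>M\<close>;
  outside \<open>span M\<close> both are \<open>undefined\<close> by extensionality.\<close>

lemma dual_space_eqI:
  assumes "\<phi> \<in> dual_space (span M)" "\<psi> \<in> dual_space (span M)" "\<And>x. x \<in> M \<Longrightarrow> \<phi> x = \<psi> x"
  shows "\<phi> = \<psi>"
proof (rule extensionalityI[of _ "span M"])
  have "span M \<subseteq> {x \<in> span M. \<phi> x = \<psi> x}"
  proof (rule span_minimal)
    \<comment> \<open>The value at 0 comes from homogeneity with scalar 0.\<close>
    have "\<phi> (0 *\<^sub>R 0) = 0" "\<psi> (0 *\<^sub>R 0) = 0"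
      using assms(1,2) by (auto simp only: dual_space_def span_zero mult_zero_left mem_Collect_eq)
    then show "subspace {x \<in> span M. \<phi> x = \<psi> x}"
      using assms(1,2)
      by (auto simp: subspace_def dual_space_def span_zero span_add span_scale)
  qed (use assms(3) in \<open>auto simp: span_base\<close>)
  then show "\<phi> x = \<psi> x" if "x \<in> span M" for x using that by blast
qed (use assms(1,2) in \<open>auto simp: dual_space_def\<close>)

section \<open>Positive critical points\<close>

text \<open>Valuations of products add, so the valuation of \<open>p\<close> extends linearly from
  \<open>M\<close>; uniqueness of the extension on the span resolves the definite description in
  \<open>Val_T\<close>.\<close>

lemma Val_T_linear_extension:
  assumes "is_lattice M" "p \<in> torus_pos M"
  obtains \<phi> where "linear \<phi>" "\<And>x. x \<in> M \<Longrightarrow> Val_K (p x) = \<phi> x"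
    "Val_T M p = restrict \<phi> (span M)"
proof -
  have "Val_K (p (x + y)) = Val_K (p x) + Val_K (p y)" if "x \<in> M" "y \<in> M" for x y
    using assms(2) that by (simp add: torus_pos_def puiseux_pos_def Val_K_mult)
  then obtain \<phi> where \<phi>: "linear \<phi>" "\<And>x. x \<in> M \<Longrightarrow> Val_K (p x) = \<phi> x"
    using additive_linear_extension[OF assms(1), of "\<lambda>x. Val_K (p x)"] by blast
  have dual: "restrict \<phi> (span M) \<in> dual_space (span M)"
    using \<phi>(1) by (simp add: dual_space_def linear_add linear_scale span_add span_scale)
  have "Val_T M p = restrict \<phi> (span M)"
    unfolding Val_T_def
  proof (rule the_equality)
    show "restrict \<phi> (span M) \<in> dual_space (span M) \<and> (\<forall>v\<in>M. Val_K (p v) = restrict \<phi> (span M) v)"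
      using dual \<phi>(2) by (simp add: span_base)
  next
    fix \<psi> assume "\<psi> \<in> dual_space (span M) \<and> (\<forall>v\<in>M. Val_K (p v) = \<psi> v)"
    then show "\<psi> = restrict \<phi> (span M)"
      using dual \<phi>(2) by (intro dual_space_eqI[of _ M]) (auto simp: span_base)
  qed
  then show ?thesis using that \<phi> by blast
qed

text \<open>The critical equations are indexed by integral cocharacters. The coordinates in a
  lattice basis are such, and every real functional is a real combination of them on the span.
  Reading the equations coefficient by coefficient lets real scalars act as complex numbers.\<close>

lemma critical_point_coeff:
  fixes l :: "'a::euclidean_space \<Rightarrow> real"
  assumes M: "is_lattice M" and v: "v ` {1..n} \<subseteq> M" and crit: "critical_point M n \<gamma> v p"
    and l: "linear l"
  shows "(\<Sum>i=1..n. of_real (l (v i)) * coeff (\<gamma> i * p (v i)) x) = 0"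
proof -
  obtain B where B: "independent B" "finite B" "span B = span M"
    "\<And>x b. x \<in> M \<Longrightarrow> representation B x b \<in> \<int>"
    using lattice_basis[OF M] by metis
  have vM: "v i \<in> M" if "i \<in> {1..n}" for i using v that by blast
  have basis: "(\<Sum>i=1..n. of_real (representation B (v i) b) * coeff (\<gamma> i * p (v i)) x) = 0" for b
  proof -
    \<comment> \<open>The coordinate is integral on \<open>M\<close>, so rounding does not change it
      there; elsewhere the values of a cocharacter are unconstrained.\<close>
    define u where "u y = \<lfloor>representation B y b\<rfloor>" for y
    have u: "real_of_int (u y) = representation B y b" if "y \<in> M" for y
      using B(4)[OF that, of b] by (simp add: u_def)
    have "u (y + z) = u y + u z" if yz: "y \<in> M" "z \<in> M" for y z
    proof -
      have "representation B (y + z) b = representation B y b + representation B z b"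
        using yz B(1,3) by (simp add: representation_add span_base)
      also have "\<dots> = real_of_int (u y + u z)" using u yz by simp
      finally show ?thesis by (simp only: u_def[of "y + z"] floor_of_int)
    qed
    then have "u \<in> cocharacters M" by (simp add: cocharacters_def)
    then have "(\<Sum>i=1..n. \<gamma> i * of_int (u (v i)) * p (v i)) = 0"
      using crit by (simp add: critical_point_def)
    then have "coeff (\<Sum>i=1..n. (\<gamma> i * p (v i)) * of_int (u (v i))) x = 0"
      by (simp add: mult_ac)
    then have "(\<Sum>i=1..n. of_int (u (v i)) * coeff (\<gamma> i * p (v i)) x) = 0"
      by (simp add: coeff_sum coeff_mult_of_int)
    moreover have "(of_int (u (v i)) :: complex) = of_real (representation B (v i) b)"
      if "i \<in> {1..n}" for i
      using u[OF vM[OF that]] by (metis of_real_of_int_eq)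
    ultimately show ?thesis by simp
  qed
  have "l (v i) = (\<Sum>b\<in>B. l b * representation B (v i) b)" if "i \<in> {1..n}" for i
  proof -
    have "v i \<in> span B" using vM[OF that] B(3) by (simp add: span_base)
    then have "v i = (\<Sum>b\<in>B. representation B (v i) b *\<^sub>R b)"
      using B(1,2) by (simp add: sum_representation_eq)
    then have "l (v i) = l (\<Sum>b\<in>B. representation B (v i) b *\<^sub>R b)" by simp
    then show ?thesis using l by (simp add: linear_sum linear_scale mult.commute)
  qed
  then have "(\<Sum>i=1..n. of_real (l (v i)) * coeff (\<gamma> i * p (v i)) x) =
      (\<Sum>i=1..n. \<Sum>b\<in>B. of_real (l b) * (of_real (representation B (v i) b) * coeff (\<gamma> i * p (v i)) x))"
    by (simp add: sum_distrib_right mult.assoc)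
  also have "\<dots> = (\<Sum>b\<in>B. \<Sum>i=1..n. of_real (l b) * (of_real (representation B (v i) b) * coeff (\<gamma> i * p (v i)) x))"
    by (rule sum.swap)
  also have "\<dots> = 0" by (simp only: sum_distrib_left[symmetric] basis mult_zero_right sum.neutral_const)
  finally show ?thesis .
qed

text \<open>Let \<open>m\<close> be the lowest valuation among the terms with
  \<open>l i \<noteq> 0\<close>. At exponent \<open>m\<close> such a term has a positive real
  coefficient if its valuation is \<open>m\<close>, and coefficient 0 otherwise. A vanishing
  weighted sum thus needs a negative weight among the terms of valuation \<open>m\<close>.\<close>

lemma leading_cancellation:
  fixes l :: "nat \<Rightarrow> real"
  assumes g: "\<And>i. i \<in> {1..n} \<Longrightarrow> g i \<in> puiseux_pos"
    and sum: "\<And>x. (\<Sum>i=1..n. of_real (l i) * coeff (g i) x) = 0"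
    and k: "k \<in> {1..n}" "l k \<noteq> 0"
  shows "\<exists>i\<in>{1..n}. l i < 0 \<and> (\<forall>j\<in>{1..n}. l j \<noteq> 0 \<longrightarrow> Val_K (g i) \<le> Val_K (g j))"
proof -
  let ?I = "{i\<in>{1..n}. l i \<noteq> 0}"
  define m where "m = Min ((\<lambda>i. Val_K (g i)) ` ?I)"
  have m_le: "m \<le> Val_K (g i)" if "i \<in> {1..n}" "l i \<noteq> 0" for i
    unfolding m_def using that by (intro Min_le) auto
  have "m \<in> (\<lambda>i. Val_K (g i)) ` ?I" unfolding m_def using k by (intro Min_in) auto
  then obtain i0 where i0: "i0 \<in> {1..n}" "l i0 \<noteq> 0" "Val_K (g i0) = m" by auto
  have lead: "Re (coeff (g i) m) \<ge> 0 \<and> (Re (coeff (g i) m) \<noteq> 0 \<longleftrightarrow> Val_K (g i) = m)"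
    if i: "i \<in> {1..n}" "l i \<noteq> 0" for i
  proof (cases "Val_K (g i) = m")
    case True
    then show ?thesis using g[OF i(1)] by (auto simp: puiseux_pos_def)
  next
    case False
    then have "coeff (g i) m = 0"
      using Val_K(2)[of "g i" m] g[OF i(1)] m_le[OF i] by (fastforce simp: puiseux_pos_def)
    then show ?thesis using False by simp
  qed
  have "Re (\<Sum>i=1..n. of_real (l i) * coeff (g i) m) = 0" by (simp only: sum zero_complex.sel)
  then have S: "(\<Sum>i=1..n. l i * Re (coeff (g i) m)) = 0" by simp
  have "\<exists>i\<in>{1..n}. l i * Re (coeff (g i) m) < 0"
  proof (rule ccontr)
    assume "\<not> ?thesis"
    then have "\<forall>i\<in>{1..n}. 0 \<le> l i * Re (coeff (g i) m)" by (meson not_le)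
    \<comment> \<open>Nonnegative summands with sum 0 all vanish, but the one at \<open>i0\<close>
      has nonzero weight and nonzero leading coefficient.\<close>
    then have "l i0 * Re (coeff (g i0) m) = 0"
      using S i0(1) sum_nonneg_eq_0_iff[of "{1..n}" "\<lambda>i. l i * Re (coeff (g i) m)"] by blast
    then show False using lead[OF i0(1,2)] i0 by simp
  qed
  then obtain i where i: "i \<in> {1..n}" "l i * Re (coeff (g i) m) < 0" by blast
  then have "l i \<noteq> 0" "Re (coeff (g i) m) \<noteq> 0" by auto
  then have "l i < 0" "Val_K (g i) = m"
    using i lead[OF i(1)] by (auto simp: mult_less_0_iff)
  then show ?thesis using i(1) m_le by auto
qed

text \<open>At \<open>p\<close> the term with index \<open>i\<close> is positive, and its valuation
  is the value of the functional at the Newton vector \<open>(Val_K (\<gamma> i), v i)\<close>.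
  Cancellation of leading terms in the critical equations is then the required condition.\<close>

lemma laurent_tropically_critical:
  assumes M: "is_lattice M" and v: "laurent_exponents M n v" and \<gamma>: "positive_laurent n \<gamma>"
    and comp: "complete_laurent M n v" and p: "p \<in> torus_pos M"
    and crit: "critical_point M n \<gamma> v p"
    and \<phi>: "linear \<phi>" "\<And>x. x \<in> M \<Longrightarrow> Val_K (p x) = \<phi> x"
  shows "tropically_critical (\<lambda>(c, x). c + \<phi> x) (laurent_datum M n \<gamma> v)"
proof -
  have vM: "v ` {1..n} \<subseteq> M" using v by (simp add: laurent_exponents_def)
  let ?W = "{(Val_K (\<gamma> i), v i) | i. i \<in> {1..n}}"
  have snd_W: "snd ` ?W = v ` {1..n}" by force
  have datum: "newton_datum (laurent_datum M n \<gamma> v)"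
    using complete_laurent_datum(1)[OF v comp] by (simp add: complete_datum_def)
  \<comment> \<open>Completeness enters through dimensions: the convex hull has the dimension of
    \<open>span M\<close> and lies in the span of the exponents.\<close>
  have span: "span (v ` {1..n}) = span M"
  proof
    show "span (v ` {1..n}) \<subseteq> span M" using vM by (rule span_mono)
    have "dim (span M) \<le> dim (span (v ` {1..n}))"
    proof -
      have "convex hull (v ` {1..n}) \<subseteq> span (v ` {1..n})" by (rule convex_hull_subset_span)
      then have "aff_dim (convex hull (v ` {1..n})) \<le> int (dim (span (v ` {1..n})))"
        using aff_dim_subset aff_dim_subspace[OF subspace_span] by metis
      then show ?thesis
        using comp by (simp add: complete_laurent_def full_dim_zero_interior_def)
    qed
    then show "span M \<subseteq> span (v ` {1..n})"
      using subspace_dim_equal[OF subspace_span subspace_span span_mono[OF vM]] by simp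
  qed
  have lin: "linear (\<lambda>(c, x). c + \<phi> x)"
    using \<phi>(1) by (intro linearI) (auto simp: linear_add linear_scale linear_0 algebra_simps)
  have pos: "\<gamma> i * p (v i) \<in> puiseux_pos" if "i \<in> {1..n}" for i
  proof (rule puiseux_pos_mult)
    show "\<gamma> i \<in> puiseux_pos" using \<gamma> that by (simp add: positive_laurent_def)
    have "v i \<in> M" using vM that by blast
    then show "p (v i) \<in> puiseux_pos" using p by (simp add: torus_pos_def)
  qed
  have val: "Val_K (\<gamma> i * p (v i)) = Val_K (\<gamma> i) + \<phi> (v i)" if i: "i \<in> {1..n}" for i
  proof -
    have "v i \<in> M" using vM i by blast
    moreover from this have "\<gamma> i \<noteq> 0" "p (v i) \<noteq> 0"
      using \<gamma> p i by (auto simp: positive_laurent_def torus_pos_def puiseux_pos_def)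
    ultimately show ?thesis using \<phi>(2) by (simp add: Val_K_mult)
  qed
  have "\<exists>w\<in>?W. l (snd w) < 0 \<and>
      (\<forall>w'\<in>?W. l (snd w') \<noteq> 0 \<longrightarrow> (\<lambda>(c, x). c + \<phi> x) w \<le> (\<lambda>(c, x). c + \<phi> x) w')"
    if l: "linear l" and ex: "\<exists>w\<in>?W. l (snd w) \<noteq> 0" for l :: "'a \<Rightarrow> real"
  proof -
    obtain k where "k \<in> {1..n}" "l (v k) \<noteq> 0" using ex by auto
    with leading_cancellation[of n "\<lambda>i. \<gamma> i * p (v i)" "\<lambda>i. l (v i)", OF pos
        critical_point_coeff[OF M vM crit l]]
    obtain i where "i \<in> {1..n}" "l (v i) < 0"
      "\<forall>j\<in>{1..n}. l (v j) \<noteq> 0 \<longrightarrow> Val_K (\<gamma> i * p (v i)) \<le> Val_K (\<gamma> j * p (v j))"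
      by blast
    then show ?thesis
      using val by (intro bexI[of _ "(Val_K (\<gamma> i), v i)"]) auto
  qed
  then show ?thesis
    using datum span lin linear_0[OF \<phi>(1)]
    unfolding tropically_critical_def laurent_datum_def newton_data.simps snd_W by auto
qed

theorem corollary4p35:
  fixes M :: "'a::euclidean_space set"
    and n :: nat
    and \<gamma> :: "nat \<Rightarrow> puiseux"
    and v :: "nat \<Rightarrow> 'a"
    and p :: "'a \<Rightarrow> puiseux"
  assumes "is_lattice M"
    and "laurent_exponents M n v"
    and "positive_laurent n \<gamma>"
    and "complete_laurent M n v"
    and "p \<in> torus_pos M"
    and "critical_point M n \<gamma> v p"
  shows "Val_T M p = d_crit (laurent_datum M n \<gamma> v) laurent_splitting"
proof -
  obtain \<phi> where \<phi>: "linear \<phi>" "\<And>x. x \<in> M \<Longrightarrow> Val_K (p x) = \<phi> x"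
    "Val_T M p = restrict \<phi> (span M)"
    using Val_T_linear_extension[OF assms(1,5)] by blast
  note laurent_tropically_critical[OF assms \<phi>(1,2)]
  then have "d_crit_tilde (laurent_datum M n \<gamma> v) = restrict (\<lambda>(c, x). c + \<phi> x) (UNIV \<times> span M)"
    using tropically_critical_unique by (fastforce simp: laurent_datum_def)
  \<comment> \<open>The splitting sends \<open>x\<close> to \<open>(0, x)\<close>, where the
    functional takes the value \<open>\<phi> x\<close>.\<close>
  then show ?thesis
    unfolding \<phi>(3) d_crit_def
    by (auto simp: laurent_datum_def laurent_splitting_def intro!: restrict_ext)
qed

end
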